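(* Let $\mathcal N$ be a symmetric multicategory. If $\mathcal N$ is representable, then so is $[\mathcal M,\mathcal N]$, for every symmetric multicategory $\mathcal M$.
   Context: A permutation $\sigma$ of the domain of an arrow $f$ in a symmetric multicategory gives an arrow $\sigma f$. For symmetric multicategories $\mathcal M,\mathcal N$, the symmetric multicategory $[\mathcal M,\mathcal N]$ has as objects the symmetric functors $\mathcal M\to\mathcal N$; an arrow $\alpha:F_1,\dots,F_n\to F$ is a family of arrows $\alpha_A:F_1A,\dots,F_nA\to FA$ in $\mathcal N$ ($A\in\mathcal M$) such that $Ff(\alpha_{A_1},\dots,\alpha_{A_m})=\sigma\,\alpha_A(F_1f,\dots,F_nf)$ for every $f:A_1,\dots,A_m\to A$ in $\mathcal M$, where $\sigma$ is the evident permutation matching the two domains; composition and symmetric structure are pointwise. An arrow $u:A_1,\dots,A_n\to A$ ($n\ge 0$) in a multicategory $\mathcal N$ is preuniversal if composition with $u$ gives a bijection $\mathcal N(A;B)\to\mathcal N(A_1,\dots,A_n;B)$ for every object $B$. $\mathcal N$ is representable if every finite sequence of objects is the domain of a preuniversal arrow and preuniversal arrows are closed under composition. *)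

theory Defs
  imports Main "HOL-Library.FuncSet" "HOL-Combinatorics.Permutations"
begin

section \<open>Permutations of concatenated lists\<close>

text \<open>
  Throughout, a permutation of a list of length n is a function permuting \<open>{..<n}\<close> and it acts
  on lists by \<^const>\<open>permute_list\<close>: the i-th entry of \<open>permute_list \<sigma> xs\<close> is \<open>xs ! \<sigma> i\<close>. The three
  permutations defined here are characterised by the lemmas following them.
\<close>

definition block_positions :: "nat list \<Rightarrow> nat list list" where
  "block_positions ks =
    map (\<lambda>i. [sum_list (take i ks) ..< sum_list (take (Suc i) ks)]) [0..<length ks]"

definition perm_of_positions :: "nat list \<Rightarrow> nat \<Rightarrow> nat" where
  "perm_of_positions ps = (\<lambda>j. if j < length ps then ps ! j else j)"

definition block_perm :: "(nat \<Rightarrow> nat) \<Rightarrow> nat list \<Rightarrow> nat \<Rightarrow> nat" where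
  "block_perm \<sigma> ks = perm_of_positions (concat (permute_list \<sigma> (block_positions ks)))"

definition juxtapose_perms :: "(nat \<Rightarrow> nat) list \<Rightarrow> nat list \<Rightarrow> nat \<Rightarrow> nat" where
  "juxtapose_perms \<sigma>s ks = perm_of_positions (concat (map2 permute_list \<sigma>s (block_positions ks)))"

definition exchange_perm :: "nat \<Rightarrow> nat \<Rightarrow> nat \<Rightarrow> nat" where
  "exchange_perm m n = (\<lambda>j. if j < m * n then (j mod n) * m + j div n else j)"

lemma block_positions_concat:
  "map (map (\<lambda>j. concat xss ! j)) (block_positions (map length xss)) = xss"
proof (rule nth_equalityI)
  show "length (map (map (\<lambda>j. concat xss ! j)) (block_positions (map length xss))) = length xss"
    by (simp add: block_positions_def)
next
  fix i assume "i < length (map (map (\<lambda>j. concat xss ! j)) (block_positions (map length xss)))"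
  then have i: "i < length xss" by (simp add: block_positions_def)
  have split: "concat xss = concat (take i xss) @ xss ! i @ concat (drop (Suc i) xss)"
    by (metis concat.simps(2) concat_append i id_take_nth_drop)
  have s: "sum_list (take i (map length xss)) = length (concat (take i xss))"
    by (simp add: length_concat take_map)
  have s': "sum_list (take (Suc i) (map length xss)) = length (concat (take i xss)) + length (xss ! i)"
    using i by (simp add: take_Suc_conv_app_nth s)
  show "map (map (\<lambda>j. concat xss ! j)) (block_positions (map length xss)) ! i = xss ! i"
    using i by (intro nth_equalityI)
      (auto simp: block_positions_def s s' split nth_append simp del: take_Suc_conv_app_nth)
qed

lemma permute_list_perm_of_positions:
  "length ps = length xs \<Longrightarrow> permute_list (perm_of_positions ps) xs = map (\<lambda>j. xs ! j) ps"
  by (intro nth_equalityI) (auto simp: permute_list_def perm_of_positions_def)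

lemma permute_list_block_perm:
  assumes "\<sigma> permutes {..<length xss}"
  shows "permute_list (block_perm \<sigma> (map length xss)) (concat xss) = concat (permute_list \<sigma> xss)"
proof -
  let ?P = "block_positions (map length xss)"
  have len: "length ?P = length xss" by (simp add: block_positions_def)
  have eq: "map (\<lambda>j. concat xss ! j) (concat (permute_list \<sigma> ?P)) = concat (permute_list \<sigma> xss)"
    using assms len by (simp add: map_concat permute_list_map[symmetric] block_positions_concat)
  have "length (concat (permute_list \<sigma> ?P)) = length (concat (permute_list \<sigma> xss))"
    by (metis eq length_map)
  also have "\<dots> = length (concat xss)"
    using assms unfolding length_concat
    by (metis mset_map mset_permute_list sum_mset_sum_list)
  finally show ?thesis
    unfolding block_perm_def by (simp only: permute_list_perm_of_positions eq)
qed

lemma permute_list_juxtapose_perms: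
  assumes "list_all2 (\<lambda>\<sigma> xs. \<sigma> permutes {..<length xs}) \<sigma>s xss"
  shows "permute_list (juxtapose_perms \<sigma>s (map length xss)) (concat xss)
    = concat (map2 permute_list \<sigma>s xss)"
proof -
  let ?P = "block_positions (map length xss)"
  have len: "length ?P = length xss" "length \<sigma>s = length xss"
    using assms by (auto simp: block_positions_def list_all2_lengthD)
  have leni: "length (?P ! i) = length (xss ! i)" if "i < length xss" for i
    using arg_cong[OF block_positions_concat[of xss], of "\<lambda>x. length (x ! i)"] that len by simp
  have "map (map (\<lambda>j. concat xss ! j)) (map2 permute_list \<sigma>s ?P) = map2 permute_list \<sigma>s xss"
  proof (rule nth_equalityI)
    fix i assume "i < length (map (map (\<lambda>j. concat xss ! j)) (map2 permute_list \<sigma>s ?P))"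
    then have i: "i < length xss" using len by simp
    have "\<sigma>s ! i permutes {..<length (?P ! i)}"
      using assms i leni len by (simp add: list_all2_conv_all_nth)
    moreover have "map (\<lambda>j. concat xss ! j) (?P ! i) = xss ! i"
      using arg_cong[OF block_positions_concat[of xss], of "\<lambda>x. x ! i"] i len by simp
    ultimately show "map (map (\<lambda>j. concat xss ! j)) (map2 permute_list \<sigma>s ?P) ! i
        = map2 permute_list \<sigma>s xss ! i"
      using i len by (simp add: permute_list_map[symmetric])
  qed (simp add: len)
  then have eq: "map (\<lambda>j. concat xss ! j) (concat (map2 permute_list \<sigma>s ?P))
      = concat (map2 permute_list \<sigma>s xss)"
    by (simp only: map_concat)
  have "map length (map2 permute_list \<sigma>s xss) = map length xss"
    using len by (intro nth_equalityI) auto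
  then have "length (concat (map2 permute_list \<sigma>s ?P)) = length (concat xss)"
    by (metis eq length_concat length_map)
  then show ?thesis
    unfolding juxtapose_perms_def by (simp only: permute_list_perm_of_positions eq)
qed

lemma length_concat_grid: "length (concat (map (\<lambda>a. map (k a) bs) as)) = length as * length bs"
  by (induction as) auto

lemma nth_concat_grid:
  "j < length as * length bs \<Longrightarrow>
    concat (map (\<lambda>a. map (k a) bs) as) ! j = k (as ! (j div length bs)) (bs ! (j mod length bs))"
proof (induction as arbitrary: j)
  case (Cons a as)
  then have pos: "length bs > 0" by (cases bs) auto
  show ?case
  proof (cases "j < length bs")
    case False
    then have "j - length bs < length as * length bs" using Cons.prems by auto
    with Cons.IH[OF this] False pos show ?thesis
      by (simp add: nth_append le_div_geq le_mod_geq)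
  qed (simp add: nth_append)
qed simp

lemma permute_list_exchange_perm:
  "permute_list (exchange_perm (length xs) (length ys)) (concat (map (\<lambda>y. map (\<lambda>x. h x y) xs) ys))
    = concat (map (\<lambda>x. map (h x) ys) xs)"
proof (rule nth_equalityI)
  fix j assume "j < length (permute_list (exchange_perm (length xs) (length ys))
    (concat (map (\<lambda>y. map (\<lambda>x. h x y) xs) ys)))"
  then have j: "j < length xs * length ys" by (simp add: length_concat_grid mult.commute)
  then have ys: "j mod length ys < length ys" by (cases ys) auto
  have xs: "j div length ys < length xs" using j by (simp add: less_mult_imp_div_less)
  define i where "i = (j mod length ys) * length xs + j div length ys"
  have "i < Suc (j mod length ys) * length xs" using xs by (simp add: i_def)
  also have "\<dots> \<le> length ys * length xs" using ys by (intro mult_le_mono1) simp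
  finally have lt: "i < length ys * length xs" .
  have i: "i div length xs = j mod length ys" "i mod length xs = j div length ys"
    using xs by (cases "length xs = 0"; simp add: i_def)+
  have "permute_list (exchange_perm (length xs) (length ys))
      (concat (map (\<lambda>y. map (\<lambda>x. h x y) xs) ys)) ! j
    = concat (map (\<lambda>y. map (\<lambda>x. h x y) xs) ys) ! i"
    using j by (simp add: permute_list_def exchange_perm_def length_concat_grid mult.commute i_def)
  also have "\<dots> = h (xs ! (j div length ys)) (ys ! (j mod length ys))"
    using nth_concat_grid[OF lt, of "\<lambda>y x. h x y"] i by simp
  also have "\<dots> = concat (map (\<lambda>x. map (h x) ys) xs) ! j"
    using nth_concat_grid[OF j, of h] by simp
  finally show "permute_list (exchange_perm (length xs) (length ys))
      (concat (map (\<lambda>y. map (\<lambda>x. h x y) xs) ys)) ! j = concat (map (\<lambda>x. map (h x) ys) xs) ! j" .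
qed (simp add: length_concat_grid mult.commute)


section \<open>Symmetric multicategories\<close>

record ('o, 'a) multicat =
  Obj :: "'o set"
  Arr :: "'a set"
  Dom :: "'a \<Rightarrow> 'o list"
  Cod :: "'a \<Rightarrow> 'o"
  Idt :: "'o \<Rightarrow> 'a"
  Comp :: "'a \<Rightarrow> 'a list \<Rightarrow> 'a"
  Act :: "(nat \<Rightarrow> nat) \<Rightarrow> 'a \<Rightarrow> 'a"

definition hom :: "('o, 'a) multicat \<Rightarrow> 'o list \<Rightarrow> 'o \<Rightarrow> 'a set" where
  "hom M As A = {f \<in> Arr M. Dom M f = As \<and> Cod M f = A}"

definition composable :: "('o, 'a) multicat \<Rightarrow> 'a \<Rightarrow> 'a list \<Rightarrow> bool" where
  "composable M f gs \<longleftrightarrow> f \<in> Arr M \<and> set gs \<subseteq> Arr M \<and> map (Cod M) gs = Dom M f"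

locale multicategory =
  fixes M :: "('o, 'a) multicat"
  assumes Dom_Obj: "f \<in> Arr M \<Longrightarrow> set (Dom M f) \<subseteq> Obj M"
    and Cod_Obj: "f \<in> Arr M \<Longrightarrow> Cod M f \<in> Obj M"
    and Idt_hom: "A \<in> Obj M \<Longrightarrow> Idt M A \<in> hom M [A] A"
    and Comp_hom: "composable M f gs \<Longrightarrow>
      Comp M f gs \<in> hom M (concat (map (Dom M) gs)) (Cod M f)"
    and Comp_Idt_left: "f \<in> Arr M \<Longrightarrow> Comp M (Idt M (Cod M f)) [f] = f"
    and Comp_Idt_right: "f \<in> Arr M \<Longrightarrow> Comp M f (map (Idt M) (Dom M f)) = f"
    and Comp_assoc: "composable M f gs \<Longrightarrow> list_all2 (composable M) gs hss \<Longrightarrow>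
      Comp M (Comp M f gs) (concat hss) = Comp M f (map2 (Comp M) gs hss)"

text \<open>
  The arrow \<open>Act M \<sigma> f\<close> is \<open>f\<close> with its inputs reordered by \<open>\<sigma>\<close>, a permutation of the positions
  of its domain; since \<^const>\<open>permute_list\<close> is a right action, so is \<^const>\<open>Act\<close>.
\<close>

locale symmetric_multicategory = multicategory +
  assumes Act_hom: "f \<in> Arr M \<Longrightarrow> \<sigma> permutes {..<length (Dom M f)} \<Longrightarrow>
      Act M \<sigma> f \<in> hom M (permute_list \<sigma> (Dom M f)) (Cod M f)"
    and Act_id: "f \<in> Arr M \<Longrightarrow> Act M id f = f"
    and Act_comp: "f \<in> Arr M \<Longrightarrow> \<sigma> permutes {..<length (Dom M f)} \<Longrightarrow>
      \<tau> permutes {..<length (Dom M f)} \<Longrightarrow> Act M (\<sigma> \<circ> \<tau>) f = Act M \<tau> (Act M \<sigma> f)"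
    and Comp_Act_outer: "composable M f gs \<Longrightarrow> \<sigma> permutes {..<length gs} \<Longrightarrow>
      Comp M (Act M \<sigma> f) (permute_list \<sigma> gs)
        = Act M (block_perm \<sigma> (map (\<lambda>g. length (Dom M g)) gs)) (Comp M f gs)"
    and Comp_Act_inner: "composable M f gs \<Longrightarrow>
      list_all2 (\<lambda>\<sigma> g. \<sigma> permutes {..<length (Dom M g)}) \<sigma>s gs \<Longrightarrow>
      Comp M f (map2 (Act M) \<sigma>s gs)
        = Act M (juxtapose_perms \<sigma>s (map (\<lambda>g. length (Dom M g)) gs)) (Comp M f gs)"

definition preuniversal :: "('o, 'a) multicat \<Rightarrow> 'a \<Rightarrow> bool" where
  "preuniversal N u \<longleftrightarrow> u \<in> Arr N \<and>
    (\<forall>B \<in> Obj N. bij_betw (\<lambda>g. Comp N g [u]) (hom N [Cod N u] B) (hom N (Dom N u) B))"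

definition representable :: "('o, 'a) multicat \<Rightarrow> bool" where
  "representable N \<longleftrightarrow>
    (\<forall>As. set As \<subseteq> Obj N \<longrightarrow> (\<exists>u. preuniversal N u \<and> Dom N u = As)) \<and>
    (\<forall>u vs. preuniversal N u \<longrightarrow> (\<forall>v \<in> set vs. preuniversal N v) \<longrightarrow> composable N u vs \<longrightarrow>
      preuniversal N (Comp N u vs))"


section \<open>The multicategory of symmetric functors\<close>

text \<open>
  The maps making up functors and transformations are required to be \<^const>\<open>extensional\<close>, so that
  equality in HOL is equality of functors and of families indexed by the objects.
\<close>

datatype ('o, 'a, 'p, 'b) mfunctor =
  MFunctor (on_obj: "'o \<Rightarrow> 'p") (on_arr: "'a \<Rightarrow> 'b")

definition symmetric_functor ::
    "('o, 'a) multicat \<Rightarrow> ('p, 'b) multicat \<Rightarrow> ('o, 'a, 'p, 'b) mfunctor \<Rightarrow> bool" where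
  "symmetric_functor M N F \<longleftrightarrow>
    on_obj F \<in> Obj M \<rightarrow>\<^sub>E Obj N \<and>
    on_arr F \<in> extensional (Arr M) \<and>
    (\<forall>f \<in> Arr M. on_arr F f \<in> hom N (map (on_obj F) (Dom M f)) (on_obj F (Cod M f))) \<and>
    (\<forall>A \<in> Obj M. on_arr F (Idt M A) = Idt N (on_obj F A)) \<and>
    (\<forall>f gs. composable M f gs \<longrightarrow>
      on_arr F (Comp M f gs) = Comp N (on_arr F f) (map (on_arr F) gs)) \<and>
    (\<forall>f \<in> Arr M. \<forall>\<sigma>. \<sigma> permutes {..<length (Dom M f)} \<longrightarrow>
      on_arr F (Act M \<sigma> f) = Act N \<sigma> (on_arr F f))"

datatype ('o, 'a, 'p, 'b) mtrans =
  MTrans (src: "('o, 'a, 'p, 'b) mfunctor list") (tgt: "('o, 'a, 'p, 'b) mfunctor")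
    (component: "'o \<Rightarrow> 'b")

text \<open>
  For \<open>f : A\<^sub>1,\<dots>,A\<^sub>m \<rightarrow> A\<close> and \<open>\<alpha> : F\<^sub>1,\<dots>,F\<^sub>n \<rightarrow> F\<close>, the domain of \<open>F f (\<alpha>\<^bsub>A\<^sub>1\<^esub>,\<dots>,\<alpha>\<^bsub>A\<^sub>m\<^esub>)\<close> lists the
  objects \<open>F\<^sub>j A\<^sub>i\<close> with \<open>j\<close> varying fastest, that of \<open>\<alpha>\<^sub>A (F\<^sub>1 f,\<dots>,F\<^sub>n f)\<close> with \<open>i\<close> varying fastest;
  \<open>exchange_perm m n\<close> reorders the latter into the former.
\<close>

definition natural :: "('o, 'a) multicat \<Rightarrow> ('p, 'b) multicat \<Rightarrow> ('o, 'a, 'p, 'b) mtrans \<Rightarrow> bool" where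
  "natural M N \<alpha> \<longleftrightarrow> (\<forall>f \<in> Arr M.
    Comp N (on_arr (tgt \<alpha>) f) (map (component \<alpha>) (Dom M f))
      = Act N (exchange_perm (length (Dom M f)) (length (src \<alpha>)))
          (Comp N (component \<alpha> (Cod M f)) (map (\<lambda>F. on_arr F f) (src \<alpha>))))"

definition functor_multicat :: "('o, 'a) multicat \<Rightarrow> ('p, 'b) multicat \<Rightarrow>
    (('o, 'a, 'p, 'b) mfunctor, ('o, 'a, 'p, 'b) mtrans) multicat" where
  "functor_multicat M N = \<lparr>
    Obj = {F. symmetric_functor M N F},
    Arr = {\<alpha>. (\<forall>F \<in> set (src \<alpha>). symmetric_functor M N F) \<and> symmetric_functor M N (tgt \<alpha>) \<and>
      component \<alpha> \<in> extensional (Obj M) \<and>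
      (\<forall>A \<in> Obj M. component \<alpha> A \<in> hom N (map (\<lambda>F. on_obj F A) (src \<alpha>)) (on_obj (tgt \<alpha>) A)) \<and>
      natural M N \<alpha>},
    Dom = src,
    Cod = tgt,
    Idt = (\<lambda>F. MTrans [F] F (\<lambda>A \<in> Obj M. Idt N (on_obj F A))),
    Comp = (\<lambda>\<alpha> \<beta>s. MTrans (concat (map src \<beta>s)) (tgt \<alpha>)
      (\<lambda>A \<in> Obj M. Comp N (component \<alpha> A) (map (\<lambda>\<beta>. component \<beta> A) \<beta>s))),
    Act = (\<lambda>\<sigma> \<alpha>. MTrans (permute_list \<sigma> (src \<alpha>)) (tgt \<alpha>)
      (\<lambda>A \<in> Obj M. Act N \<sigma> (component \<alpha> A)))\<rparr>"

end

theory Submission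
  imports Defs
begin

text \<open>
  In a representable multicategory, composition with a whole list of preuniversal arrows is
  bijective. Hence, given functors \<open>F\<^sub>1,\<dots>,F\<^sub>n\<close> and a preuniversal \<open>u\<^sub>A : F\<^sub>1A,\<dots>,F\<^sub>nA \<rightarrow> TA\<close> for each
  object \<open>A\<close>, the naturality condition \<open>Tf(u\<^bsub>A\<^sub>1\<^esub>,\<dots>,u\<^bsub>A\<^sub>m\<^esub>) = \<sigma> u\<^sub>A(F\<^sub>1f,\<dots>,F\<^sub>nf)\<close> determines \<open>T\<close> on arrows, and
  uniqueness makes \<open>T\<close> a symmetric functor. The same cancellation shows that every pointwise
  preuniversal transformation is preuniversal. Conversely, a preuniversal transformation differs from
  the pointwise one with the same domain by an isomorphism, so it is pointwise preuniversal as well;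
  closure under composition is then inherited from the codomain.
\<close>

section \<open>Identities between permutations of concatenated lists\<close>

text \<open>What shapes the proof is the permutation in the naturality condition. For an arrow with
  m inputs and n functors it is the transposition of an m by n grid, and the laws for T on
  composites, like the naturality of composite transformations, compare several transpositions with
  a single one. Three identities settle this: \<open>exchange_perm_sum_list_left\<close> makes T
  preserve composition, \<open>exchange_perm_sum_list_right\<close> makes composites of
  transformations natural, and \<open>exchange_perm_equivariant\<close> makes T respect the
  symmetric action. The other obstacle is that preuniversality tests composition with one arrow
  only, while naturality at f involves the m arrows u at the inputs of f, with m possibly 0; closure
  under composition is what allows whole lists to be cancelled. Finally, the closure clause for
  transformations starts from arbitrary preuniversal ones, about whose components nothing is known
  beforehand; this is why a converse to the pointwise criterion is required.\<close>

lemma permutes_eqI: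
  assumes "\<sigma> permutes {..<length xs}" "\<tau> permutes {..<length xs}" "distinct xs"
    and eq: "permute_list \<sigma> xs = permute_list \<tau> xs"
  shows "\<sigma> = \<tau>"
proof
  fix j
  show "\<sigma> j = \<tau> j"
  proof (cases "j < length xs")
    case True
    then have "xs ! \<sigma> j = xs ! \<tau> j"
      using arg_cong[OF eq, of "\<lambda>l. l ! j"] assms(1,2) by (simp add: permute_list_nth)
    moreover have "\<sigma> j < length xs" "\<tau> j < length xs"
      using True assms(1,2) by (auto dest: permutes_in_image)
    ultimately show ?thesis using assms(3) by (simp add: nth_eq_iff_index_eq)
  next
    case False
    then show ?thesis using assms(1,2) by (simp add: permutes_not_in)
  qed
qed

section \<open>Block and juxtaposed permutations\<close>

lemma length_block_positions [simp]: "length (block_positions ks) = length ks"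
  by (simp add: block_positions_def)

lemma map_length_block_positions [simp]: "map length (block_positions ks) = ks"
  by (rule nth_equalityI) (simp_all add: block_positions_def take_Suc_conv_app_nth)

lemma concat_upt_blocks:
  fixes s :: "nat \<Rightarrow> nat"
  assumes "mono s"
  shows "concat (map (\<lambda>i. [s i..<s (Suc i)]) [0..<n]) = [s 0..<s n]"
proof (induction n)
  case (Suc n)
  have "s 0 \<le> s n" "s n \<le> s (Suc n)" using assms by (auto simp: mono_def)
  then have "[s 0..<s (Suc n)] = [s 0..<s n] @ [s n..<s (Suc n)]"
    using upt_add_eq_append[of "s 0" "s n" "s (Suc n) - s n"] by (simp only: le_add_diff_inverse)
  then show ?case using Suc by simp
qed simp

lemma concat_block_positions: "concat (block_positions ks) = [0..<sum_list ks]"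
proof -
  have "mono (\<lambda>i. sum_list (take i ks))"
  proof (rule monoI)
    fix i j :: nat assume "i \<le> j"
    then have "take j ks = take i ks @ take (j - i) (drop i ks)"
      by (metis le_add_diff_inverse take_add)
    then show "sum_list (take i ks) \<le> sum_list (take j ks)" by simp
  qed
  from concat_upt_blocks[OF this, of "length ks"] show ?thesis
    by (simp add: block_positions_def)
qed

text \<open>A rearrangement of \<open>[0..<n]\<close> is the one-line notation of a permutation: it
  has no repetitions, so indexing is injective, and its entries fill the range. From
  \<open>n\<close> on, the default value is the identity.\<close>

lemma perm_of_positions_permutes:
  assumes "mset ps = mset [0..<n]"
  shows "perm_of_positions ps permutes {..<n}"
proof -
  have len: "length ps = n" using mset_eq_length[OF assms] by simp
  have "distinct ps" using mset_eq_imp_distinct_iff[OF assms] by simp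
  then have "bij_betw ((!) ps) {..<n} (set ps)" using len by (intro bij_betw_nth) simp_all
  moreover have "set ps = {..<n}" using mset_eq_setD[OF assms] by (simp add: atLeast0LessThan)
  moreover have "bij_betw (perm_of_positions ps) {..<n} {..<n} \<longleftrightarrow> bij_betw ((!) ps) {..<n} {..<n}"
    by (rule bij_betw_cong) (simp add: perm_of_positions_def len)
  ultimately show ?thesis
    by (intro bij_imp_permutes) (simp_all add: perm_of_positions_def len)
qed

lemma mset_concat_permute_list:
  assumes "\<sigma> permutes {..<length xss}"
  shows "mset (concat (permute_list \<sigma> xss)) = mset (concat xss)"
proof -
  have "mset (map mset (permute_list \<sigma> xss)) = mset (map mset xss)"
    using assms by simp
  then have "sum_list (map mset (permute_list \<sigma> xss)) = sum_list (map mset xss)"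
    by (metis sum_mset_sum_list)
  then show ?thesis by (simp add: mset_concat)
qed

lemma block_perm_permutes:
  assumes "\<sigma> permutes {..<length ks}"
  shows "block_perm \<sigma> ks permutes {..<sum_list ks}"
  unfolding block_perm_def
  using assms by (intro perm_of_positions_permutes)
    (simp add: mset_concat_permute_list concat_block_positions)

lemma juxtapose_perms_permutes:
  assumes "list_all2 (\<lambda>\<sigma> k. \<sigma> permutes {..<k}) \<sigma>s ks"
  shows "juxtapose_perms \<sigma>s ks permutes {..<sum_list ks}"
proof -
  \<comment> \<open>Each inner permutation stays within its own block, so the blocks keep their
    multisets of positions one by one.\<close>
  have "map mset (map2 permute_list \<sigma>s (block_positions ks)) = map mset (block_positions ks)"
  proof (rule nth_equalityI)
    fix i assume "i < length (map mset (map2 permute_list \<sigma>s (block_positions ks)))"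
    then have i: "i < length \<sigma>s" "i < length ks" by auto
    have "length (block_positions ks ! i) = ks ! i"
      using i nth_map[of i "block_positions ks" length] by simp
    then show "map mset (map2 permute_list \<sigma>s (block_positions ks)) ! i
        = map mset (block_positions ks) ! i"
      using i assms by (simp add: list_all2_conv_all_nth)
  qed (use assms in \<open>simp add: list_all2_lengthD\<close>)
  then have "mset (concat (map2 permute_list \<sigma>s (block_positions ks))) = mset [0..<sum_list ks]"
    by (metis mset_concat concat_block_positions)
  then show ?thesis unfolding juxtapose_perms_def by (rule perm_of_positions_permutes)
qed

text \<open>Position \<open>i * n + k\<close> with \<open>k < n\<close> goes to
  \<open>k * m + i\<close>, which is the transposition of a grid read row by row. Transposing back,
  by \<open>exchange_perm n m\<close>, is the inverse.\<close>

lemma exchange_perm_permutes: "exchange_perm m n permutes {..<m * n}"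
proof (rule bij_imp_permutes)
  have *: "exchange_perm m n j < m * n \<and> exchange_perm n m (exchange_perm m n j) = j"
    if j: "j < m * n" for m n j
  proof -
    have pos: "0 < m" "0 < n" using j by (auto intro: Nat.gr0I)
    have lt: "j mod n < n" "j div n < m"
      using j pos by (auto simp: less_mult_imp_div_less)
    define q where "q = (j mod n) * m + j div n"
    have "q < Suc (j mod n) * m" using lt by (simp add: q_def)
    also have "\<dots> \<le> n * m" using lt by (intro mult_le_mono1) simp
    finally have q: "q < n * m" .
    have *: "q mod m = j div n" "q div m = j mod n" using lt by (auto simp: q_def)
    have "(q mod m) * n + q div m = j" by (simp only: *) (rule div_mult_mod_eq)
    moreover have "exchange_perm m n j = q" using j by (simp add: exchange_perm_def q_def)
    moreover have "exchange_perm n m q = (q mod m) * n + q div m"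
      using q by (simp add: exchange_perm_def)
    ultimately show ?thesis using q by (simp add: mult.commute[of n m])
  qed
  show "bij_betw (exchange_perm m n) {..<m * n} {..<m * n}"
    using * *[of _ n m]
    by (intro bij_betw_byWitness[where f' = "exchange_perm n m"]) (auto simp: mult.commute)
qed (simp add: exchange_perm_def)

lemma exchange_perm_permutes': "exchange_perm m n permutes {..<n * m}"
  using exchange_perm_permutes[of m n] by (simp only: mult.commute)

text \<open>A grid with a single row or a single column looks the same after transposition.
  Naturality therefore carries no permutation at unary arrows of \<open>M\<close>, such as
  identities, and for unary transformations.\<close>

lemma exchange_perm_1_left [simp]: "exchange_perm (Suc 0) n = id"
  by (auto simp: exchange_perm_def fun_eq_iff)

lemma exchange_perm_1_right [simp]: "exchange_perm m (Suc 0) = id"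
  by (auto simp: exchange_perm_def fun_eq_iff)

lemma juxtapose_perms_singleton:
  assumes "\<sigma> permutes {..<n}"
  shows "juxtapose_perms [\<sigma>] [n] = \<sigma>"
  using permute_list_juxtapose_perms[of "[\<sigma>]" "[[0..<n]]"] assms
    juxtapose_perms_permutes[of "[\<sigma>]" "[n]"]
  by (intro permutes_eqI[where xs = "[0..<n]"]) auto

lemma sum_list_concat_replicate: "sum_list (concat (replicate n ks)) = n * sum_list (ks :: nat list)"
  by (induction n) auto

lemma sum_list_concat_map_replicate:
  "sum_list (concat (map (\<lambda>k. replicate m k) ks)) = m * sum_list (ks :: nat list)"
  by (induction ks) (auto simp: sum_list_replicate algebra_simps)

lemma concat_map_concat: "concat (map f (concat xss)) = concat (map (\<lambda>xs. concat (map f xs)) xss)"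
  by (induction xss) auto

lemma distinct_grid:
  assumes "distinct xs" "distinct ys"
  shows "distinct (concat (map (\<lambda>y. map (\<lambda>x. (x, y)) xs) ys))"
  using assms(2) by (induction ys) (use assms(1) in \<open>auto simp: distinct_map inj_on_def\<close>)

text \<open>
  In the next three lemmas a permutation is determined by what it does to a list of distinct
  pairs, where each factor only changes the order in which the indices are run through.
\<close>

lemma exchange_perm_sum_list_left:
  "block_perm (exchange_perm (length ks) n) (concat (replicate n ks))
      \<circ> juxtapose_perms (map (\<lambda>k. exchange_perm k n) ks) (map (\<lambda>k. n * k) ks)
    = exchange_perm (sum_list ks) n" (is "?b \<circ> ?j = ?e")
proof -
  \<comment> \<open>The positions themselves, cut into blocks of lengths \<open>ks\<close>, serve as
    distinct labels with the prescribed block lengths.\<close>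
  define xss where "xss = block_positions ks"
  define ys where "ys = [0..<n]"
  have ks: "map length xss = ks" by (simp add: xss_def)
  have lks: "length xss = length ks" by (simp add: xss_def)
  have lcx: "length (concat xss) = sum_list ks" by (simp add: ks length_concat)
  have n: "length ys = n" by (simp add: ys_def)
  define L where "L = concat (map (\<lambda>y. map (\<lambda>x. (x, y)) (concat xss)) ys)"
  have len: "length L = sum_list ks * n"
    by (simp add: L_def length_concat_grid lcx n mult.commute)
  have dist: "distinct L"
    unfolding L_def by (intro distinct_grid) (simp_all add: xss_def concat_block_positions ys_def)
  have b: "?b permutes {..<length L}"
    using block_perm_permutes[of "exchange_perm (length ks) n" "concat (replicate n ks)"]
      exchange_perm_permutes[of "length ks" n]
    by (simp add: len length_concat sum_list_replicate sum_list_concat_replicate mult.commute)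
  have "sum_list (map (\<lambda>k. n * k) ks) = length L"
    by (simp add: len sum_list_const_mult[of n id, simplified] mult.commute[of _ n])
  then have j: "?j permutes {..<length L}"
    using juxtapose_perms_permutes[of "map (\<lambda>k. exchange_perm k n) ks" "map (\<lambda>k. n * k) ks"]
    by (simp only:) (simp add: list_all2_conv_all_nth exchange_perm_permutes')
  have e: "?e permutes {..<length L}" by (simp add: len exchange_perm_permutes)
  \<comment> \<open>\<open>L\<close> is a nested loop in the order y, block, entry. The block
    permutation makes it block, y, entry; the juxtaposed exchanges make that block, entry, y. This
    is the order in which the exchange of the whole grid runs.\<close>
  define B where "B = concat (map (\<lambda>y. map (\<lambda>xs. map (\<lambda>x. (x, y)) xs) xss) ys)"
  have L: "L = concat B"
    unfolding L_def B_def by (induction ys) (simp_all add: map_concat)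
  have lB: "map length B = concat (replicate n ks)"
    by (simp add: B_def map_concat comp_def ks map_replicate_const n)
  have "permute_list ?b L = concat (permute_list (exchange_perm (length ks) n) B)"
    using permute_list_block_perm[of "exchange_perm (length ks) n" B]
      exchange_perm_permutes[of "length ks" n]
    by (simp add: L lB) (simp add: B_def length_concat_grid lks n mult.commute)
  also have "permute_list (exchange_perm (length ks) n) B
      = concat (map (\<lambda>xs. map (\<lambda>y. map (\<lambda>x. (x, y)) xs) ys) xss)"
    unfolding B_def lks[symmetric] n[symmetric] by (rule permute_list_exchange_perm)
  also have "concat \<dots> = concat (map (\<lambda>xs. concat (map (\<lambda>y. map (\<lambda>x. (x, y)) xs) ys)) xss)"
    (is "_ = concat ?C")
    by (induction xss) simp_all
  finally have 1: "permute_list ?b L = concat ?C" .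
  have lC: "map length ?C = map (\<lambda>k. n * k) ks"
    by (simp add: length_concat_grid n flip: ks)
  have "permute_list (?b \<circ> ?j) L = permute_list ?j (concat ?C)"
    using j by (simp add: permute_list_compose 1)
  also have "\<dots> = concat (map2 permute_list (map (\<lambda>k. exchange_perm k n) ks) ?C)"
    unfolding lC[symmetric]
    by (rule permute_list_juxtapose_perms)
      (simp add: list_all2_conv_all_nth length_concat_grid n exchange_perm_permutes' flip: ks)
  also have "map2 permute_list (map (\<lambda>k. exchange_perm k n) ks) ?C
      = map (\<lambda>xs. concat (map (\<lambda>x. map (Pair x) ys) xs)) xss"
    by (rule nth_equalityI)
      (simp_all add: permute_list_exchange_perm flip: ks n)
  also have "concat \<dots> = concat (map (\<lambda>x. map (Pair x) ys) (concat xss))"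
    by (simp add: concat_map_concat)
  also have "\<dots> = permute_list ?e L"
    unfolding L_def lcx[symmetric] n[symmetric] by (rule permute_list_exchange_perm[symmetric])
  finally show ?thesis
    using b j e dist by (intro permutes_eqI[where xs = L] permutes_compose)
qed

lemma exchange_perm_sum_list_right:
  "juxtapose_perms (map (\<lambda>k. exchange_perm m k) ks) (map (\<lambda>k. k * m) ks)
      \<circ> block_perm (exchange_perm m (length ks)) (concat (map (\<lambda>k. replicate m k) ks))
    = exchange_perm m (sum_list ks)" (is "?j \<circ> ?b = ?e")
proof -
  define yss where "yss = block_positions ks"
  define xs where "xs = [0..<m]"
  have ks: "map length yss = ks" by (simp add: yss_def)
  have lks: "length yss = length ks" by (simp add: yss_def)
  have lcy: "length (concat yss) = sum_list ks" by (simp add: ks length_concat)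
  have m: "length xs = m" by (simp add: xs_def)
  define L where "L = concat (map (\<lambda>y. map (\<lambda>x. (x, y)) xs) (concat yss))"
  have len: "length L = m * sum_list ks"
    by (simp add: L_def length_concat_grid lcy m mult.commute)
  have dist: "distinct L"
    unfolding L_def by (intro distinct_grid) (simp_all add: yss_def concat_block_positions xs_def)
  have b: "?b permutes {..<length L}"
    using block_perm_permutes[of "exchange_perm m (length ks)" "concat (map (\<lambda>k. replicate m k) ks)"]
      exchange_perm_permutes[of m "length ks"]
    by (simp add: len length_concat sum_list_triv comp_def sum_list_concat_map_replicate mult.commute)
  have "sum_list (map (\<lambda>k. k * m) ks) = length L"
    by (simp add: len sum_list_mult_const[of id, simplified] mult.commute[of m])
  then have j: "?j permutes {..<length L}"
    using juxtapose_perms_permutes[of "map (\<lambda>k. exchange_perm m k) ks" "map (\<lambda>k. k * m) ks"]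
    by (simp only:) (simp add: list_all2_conv_all_nth exchange_perm_permutes')
  have e: "?e permutes {..<length L}" by (simp add: len exchange_perm_permutes)
  \<comment> \<open>Here the loop order of \<open>L\<close> is block, y, x. The juxtaposed exchanges
    make it block, x, y, and the block permutation then moves x to the outside: x, block, y.\<close>
  define C where "C = map (\<lambda>ys. concat (map (\<lambda>y. map (\<lambda>x. (x, y)) xs) ys)) yss"
  have L: "L = concat C" by (simp add: L_def C_def concat_map_concat)
  have lC: "map length C = map (\<lambda>k. k * m) ks"
    by (simp add: C_def length_concat_grid m flip: ks)
  have "permute_list ?j L = concat (map2 permute_list (map (\<lambda>k. exchange_perm m k) ks) C)"
    unfolding lC[symmetric] L
    by (rule permute_list_juxtapose_perms)
      (simp add: C_def list_all2_conv_all_nth length_concat_grid m exchange_perm_permutes' flip: ks)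
  also have "map2 permute_list (map (\<lambda>k. exchange_perm m k) ks) C
      = map (\<lambda>ys. concat (map (\<lambda>x. map (Pair x) ys) xs)) yss"
    by (rule nth_equalityI)
      (simp_all add: C_def permute_list_exchange_perm flip: ks m)
  also have "concat \<dots> = concat (concat (map (\<lambda>ys. map (\<lambda>x. map (Pair x) ys) xs) yss))"
    (is "_ = concat ?B")
    by (induction yss) simp_all
  finally have 1: "permute_list ?j L = concat ?B" .
  have lB: "map length ?B = concat (map (\<lambda>k. replicate m k) ks)"
    by (simp add: map_concat comp_def map_replicate_const m flip: ks)
  have "permute_list (?j \<circ> ?b) L = permute_list ?b (concat ?B)"
    using b by (simp add: permute_list_compose 1)
  also have "\<dots> = concat (permute_list (exchange_perm m (length ks)) ?B)"
    unfolding lB[symmetric]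
    by (rule permute_list_block_perm)
      (use exchange_perm_permutes[of m "length ks"] in
        \<open>simp add: length_concat_grid lks m mult.commute\<close>)
  also have "permute_list (exchange_perm m (length ks)) ?B
      = concat (map (\<lambda>x. map (\<lambda>ys. map (Pair x) ys) yss) xs)"
    unfolding lks[symmetric] m[symmetric] by (rule permute_list_exchange_perm)
  also have "concat \<dots> = concat (map (\<lambda>x. map (Pair x) (concat yss)) xs)"
    by (induction xs) (simp_all add: map_concat)
  also have "\<dots> = permute_list ?e L"
    unfolding L_def lcy[symmetric] m[symmetric] by (rule permute_list_exchange_perm[symmetric])
  finally show ?thesis
    using b j e dist by (intro permutes_eqI[where xs = L] permutes_compose)
qed

lemma exchange_perm_equivariant:
  assumes \<tau>: "\<tau> permutes {..<m}"
  shows "exchange_perm m n \<circ> block_perm \<tau> (replicate m n)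
    = juxtapose_perms (replicate n \<tau>) (replicate n m) \<circ> exchange_perm m n" (is "?e \<circ> ?b = ?j \<circ> ?e")
proof -
  define xs where "xs = [0..<m]"
  define ys where "ys = [0..<n]"
  have m: "length xs = m" and n: "length ys = n" by (simp_all add: xs_def ys_def)
  define C where "C = map (\<lambda>y. map (\<lambda>x. (x, y)) xs) ys"
  define L where "L = concat C"
  have len: "length L = m * n" by (simp add: L_def C_def length_concat_grid m n mult.commute)
  have dist: "distinct L"
    unfolding L_def C_def by (intro distinct_grid) (simp_all add: xs_def ys_def)
  have b: "?b permutes {..<length L}"
    using block_perm_permutes[of \<tau> "replicate m n"] \<tau> by (simp add: len sum_list_replicate)
  have j: "?j permutes {..<length L}"
    using juxtapose_perms_permutes[of "replicate n \<tau>" "replicate n m"] \<tau>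
    by (simp add: len sum_list_replicate list_all2_conv_all_nth mult.commute)
  have e: "?e permutes {..<length L}" by (simp add: len exchange_perm_permutes)
  have "permute_list ?e L = concat (map (\<lambda>x. map (Pair x) ys) xs)" (is "_ = concat ?B")
    unfolding L_def C_def m[symmetric] n[symmetric] by (rule permute_list_exchange_perm)
  then have "permute_list (?e \<circ> ?b) L = permute_list ?b (concat ?B)"
    using b by (simp add: permute_list_compose)
  also have "\<dots> = concat (permute_list \<tau> ?B)"
    using permute_list_block_perm[of \<tau> ?B] \<tau> by (simp add: m n comp_def map_replicate_const)
  also have "\<dots> = concat (map (\<lambda>x. map (Pair x) ys) (permute_list \<tau> xs))"
    using \<tau> by (simp add: permute_list_map m)
  \<comment> \<open>Reordering the x's on the outside after the exchange gives the same list as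
    reordering them inside every row before it.\<close>
  also have "\<dots> = permute_list ?e (concat (map (\<lambda>y. map (\<lambda>x. (x, y)) (permute_list \<tau> xs)) ys))"
    using permute_list_exchange_perm[of "permute_list \<tau> xs" ys Pair] by (simp add: m n)
  also have "map (\<lambda>y. map (\<lambda>x. (x, y)) (permute_list \<tau> xs)) ys = map2 permute_list (replicate n \<tau>) C"
    using \<tau> by (intro nth_equalityI) (simp_all add: C_def n m permute_list_map)
  also have "concat \<dots> = permute_list ?j L"
    using permute_list_juxtapose_perms[of "replicate n \<tau>" C] \<tau>
    by (simp add: L_def C_def list_all2_conv_all_nth m n comp_def map_replicate_const)
  also have "permute_list ?e (permute_list ?j L) = permute_list (?j \<circ> ?e) L"
    using e by (simp add: permute_list_compose)
  finally show ?thesis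
    using b j e dist by (intro permutes_eqI[where xs = L] permutes_compose)
qed

section \<open>Multicategories and preuniversal arrows\<close>

lemma hom_iff: "f \<in> hom M As A \<longleftrightarrow> f \<in> Arr M \<and> Dom M f = As \<and> Cod M f = A"
  by (simp add: hom_def)

lemma composableI:
  "f \<in> Arr M \<Longrightarrow> (\<And>g. g \<in> set gs \<Longrightarrow> g \<in> Arr M) \<Longrightarrow> map (Cod M) gs = Dom M f \<Longrightarrow> composable M f gs"
  by (auto simp: composable_def)

context multicategory
begin

lemma Comp_Arr: "composable M f gs \<Longrightarrow> Comp M f gs \<in> Arr M"
  and Dom_Comp: "composable M f gs \<Longrightarrow> Dom M (Comp M f gs) = concat (map (Dom M) gs)"
  and Cod_Comp: "composable M f gs \<Longrightarrow> Cod M (Comp M f gs) = Cod M f"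
  using Comp_hom[of f gs] by (simp_all add: hom_iff)

lemma Idt_Arr: "A \<in> Obj M \<Longrightarrow> Idt M A \<in> Arr M"
  and Dom_Idt: "A \<in> Obj M \<Longrightarrow> Dom M (Idt M A) = [A]"
  and Cod_Idt: "A \<in> Obj M \<Longrightarrow> Cod M (Idt M A) = A"
  using Idt_hom[of A] by (simp_all add: hom_iff)

text \<open>Indexing the middle arrows and their argument lists by one common list removes the
  \<open>map2\<close>, so that associativity can be used directly on families given by a
  function.\<close>

lemma Comp_assoc_map:
  assumes "composable M f (map g xs)" "\<And>x. x \<in> set xs \<Longrightarrow> composable M (g x) (hs x)"
  shows "Comp M (Comp M f (map g xs)) (concat (map hs xs)) = Comp M f (map (\<lambda>x. Comp M (g x) (hs x)) xs)"
proof -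
  have "map2 (Comp M) (map g xs) (map hs xs) = map (\<lambda>x. Comp M (g x) (hs x)) xs"
    by (induction xs) simp_all
  moreover have "list_all2 (composable M) (map g xs) (map hs xs)"
    using assms(2) by (simp add: list.rel_map list_all2_same)
  from Comp_assoc[OF assms(1) this]
  have "Comp M (Comp M f (map g xs)) (concat (map hs xs)) = Comp M f (map2 (Comp M) (map g xs) (map hs xs))" .
  ultimately show ?thesis by (simp only:)
qed

lemma Comp_assoc_single:
  "composable M f [g] \<Longrightarrow> composable M g hs \<Longrightarrow> Comp M (Comp M f [g]) hs = Comp M f [Comp M g hs]"
  using Comp_assoc_map[of f "\<lambda>_. g" "[()]" "\<lambda>_. hs"] by simp

section \<open>Factorization, cancellation and uniqueness up to isomorphism\<close>

lemma preuniversal_factor: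
  assumes "preuniversal M u" "h \<in> hom M (Dom M u) B"
  obtains g where "g \<in> hom M [Cod M u] B" "Comp M g [u] = h"
proof -
  have "B \<in> Obj M" using assms(2) Cod_Obj by (auto simp: hom_iff)
  then have "h \<in> (\<lambda>g. Comp M g [u]) ` hom M [Cod M u] B"
    using assms by (simp add: preuniversal_def bij_betw_def)
  then show ?thesis using that by blast
qed

lemma preuniversal_cancel:
  assumes "preuniversal M u" "g \<in> hom M [Cod M u] B" "g' \<in> hom M [Cod M u] B"
    "Comp M g [u] = Comp M g' [u]"
  shows "g = g'"
proof -
  have "B \<in> Obj M" using assms(2) Cod_Obj by (auto simp: hom_iff)
  then show ?thesis using assms unfolding preuniversal_def bij_betw_def inj_on_def by blast
qed

lemma preuniversalI:
  assumes u: "u \<in> Arr M"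
    and ex: "\<And>h. h \<in> Arr M \<Longrightarrow> Dom M h = Dom M u \<Longrightarrow> \<exists>g \<in> hom M [Cod M u] (Cod M h). Comp M g [u] = h"
    and cancel: "\<And>g g'. g \<in> Arr M \<Longrightarrow> g' \<in> Arr M \<Longrightarrow> Dom M g = [Cod M u] \<Longrightarrow> Dom M g' = [Cod M u] \<Longrightarrow>
      Cod M g = Cod M g' \<Longrightarrow> Comp M g [u] = Comp M g' [u] \<Longrightarrow> g = g'"
  shows "preuniversal M u"
proof -
  have closed: "Comp M g [u] \<in> hom M (Dom M u) B" if "g \<in> hom M [Cod M u] B" for g B
    using that u Comp_hom[of g "[u]"] by (auto simp: hom_iff composable_def)
  have "bij_betw (\<lambda>g. Comp M g [u]) (hom M [Cod M u] B) (hom M (Dom M u) B)" for B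
  proof (rule bij_betw_imageI)
    show "inj_on (\<lambda>g. Comp M g [u]) (hom M [Cod M u] B)"
      by (rule inj_onI, rule cancel) (auto simp: hom_iff)
    show "(\<lambda>g. Comp M g [u]) ` hom M [Cod M u] B = hom M (Dom M u) B"
    proof
      show "hom M (Dom M u) B \<subseteq> (\<lambda>g. Comp M g [u]) ` hom M [Cod M u] B"
      proof
        fix h assume "h \<in> hom M (Dom M u) B"
        with ex[of h] show "h \<in> (\<lambda>g. Comp M g [u]) ` hom M [Cod M u] B" by (auto simp: hom_iff)
      qed
    qed (use closed in blast)
  qed
  then show ?thesis using u by (simp add: preuniversal_def)
qed

text \<open>Composition with \<open>b(u)\<close> is composition with \<open>b\<close> followed by
  composition with \<open>u\<close>, and the former is invertible because \<open>b\<close> is. A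
  factorization through \<open>u\<close> becomes one through \<open>b(u)\<close> after composition
  with the inverse \<open>c\<close>.\<close>

lemma preuniversal_Comp_iso:
  assumes u: "preuniversal M u"
    and b: "b \<in> hom M [Cod M u] C" and c: "c \<in> hom M [C] (Cod M u)"
    and cb: "Comp M c [b] = Idt M (Cod M u)" and bc: "Comp M b [c] = Idt M C"
  shows "preuniversal M (Comp M b [u])"
proof (rule preuniversalI)
  have uA: "u \<in> Arr M" using u by (simp add: preuniversal_def)
  have bu: "composable M b [u]" using uA b by (simp add: composable_def hom_iff)
  have cb': "composable M c [b]" and bc': "composable M b [c]"
    using b c by (simp_all add: composable_def hom_iff)
  show "Comp M b [u] \<in> Arr M" using bu by (rule Comp_Arr)
  have cbu: "Comp M c [Comp M b [u]] = u"
    using Comp_assoc_single[OF cb' bu] cb Comp_Idt_left[OF uA] by simp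
  {
    fix h assume h: "h \<in> Arr M" "Dom M h = Dom M (Comp M b [u])"
    then have "h \<in> hom M (Dom M u) (Cod M h)" by (simp add: hom_iff Dom_Comp bu)
    then obtain g where g: "g \<in> hom M [Cod M u] (Cod M h)" "Comp M g [u] = h"
      by (rule preuniversal_factor[OF u])
    have gc: "composable M g [c]" using g c by (simp add: composable_def hom_iff)
    have "composable M c [Comp M b [u]]"
      using c b bu by (simp add: composable_def hom_iff Comp_Arr Cod_Comp)
    then have "Comp M (Comp M g [c]) [Comp M b [u]] = h"
      using Comp_assoc_single[OF gc] cbu g(2) by simp
    moreover have "Comp M g [c] \<in> hom M [Cod M (Comp M b [u])] (Cod M h)"
      using Comp_hom[OF gc] g(1) b c by (simp add: hom_iff Cod_Comp[OF bu])
    ultimately show "\<exists>g \<in> hom M [Cod M (Comp M b [u])] (Cod M h). Comp M g [Comp M b [u]] = h"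
      by blast
  next
    fix g g'
    assume g: "g \<in> Arr M" "g' \<in> Arr M" "Dom M g = [Cod M (Comp M b [u])]"
      "Dom M g' = [Cod M (Comp M b [u])]" "Cod M g = Cod M g'"
      and eq: "Comp M g [Comp M b [u]] = Comp M g' [Comp M b [u]]"
    have comp: "composable M g [b]" "composable M g' [b]"
      using g b by (simp_all add: composable_def hom_iff Cod_Comp[OF bu])
    then have eq_gb: "Comp M (Comp M g [b]) [u] = Comp M (Comp M g' [b]) [u]"
      using eq by (simp add: Comp_assoc_single bu)
    have gb: "Comp M g [b] = Comp M g' [b]"
      by (rule preuniversal_cancel[OF u, of _ "Cod M g", rotated 2, OF eq_gb])
        (use comp g b in \<open>simp_all add: hom_iff Comp_Arr Dom_Comp Cod_Comp\<close>)
    \<comment> \<open>Composition with \<open>b\<close> is undone by composition with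
      \<open>c\<close>, so equality of \<open>g(b)\<close> and \<open>g'(b)\<close>
      suffices.\<close>
    have retract: "Comp M (Comp M k [b]) [c] = k" if "k \<in> Arr M" "Dom M k = [C]" for k
    proof -
      have "composable M k [b]" using that b by (simp add: composable_def hom_iff)
      then show ?thesis
        using that bc Comp_Idt_right[of k] by (simp add: Comp_assoc_single bc')
    qed
    have "Cod M (Comp M b [u]) = C" using b by (simp add: Cod_Comp[OF bu] hom_iff)
    then have "g = Comp M (Comp M g [b]) [c]" using g by (intro retract[symmetric]) simp_all
    also have "\<dots> = g'" unfolding gb using g \<open>Cod M (Comp M b [u]) = C\<close> by (intro retract) simp_all
    finally show "g = g'" .
  }
qed

text \<open>The usual uniqueness of universal arrows: each of \<open>u\<close>, \<open>v\<close>
  factors through the other, and the composite factorizations agree with identities after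
  composition with \<open>u\<close> or \<open>v\<close>, which can be cancelled.\<close>

lemma preuniversal_iso:
  assumes u: "preuniversal M u" and v: "preuniversal M v" and D: "Dom M u = Dom M v"
  obtains b c where "b \<in> hom M [Cod M u] (Cod M v)" "c \<in> hom M [Cod M v] (Cod M u)"
    "Comp M b [u] = v" "Comp M c [b] = Idt M (Cod M u)" "Comp M b [c] = Idt M (Cod M v)"
proof -
  have A: "u \<in> Arr M" "v \<in> Arr M" using u v by (simp_all add: preuniversal_def)
  obtain b where b: "b \<in> hom M [Cod M u] (Cod M v)" "Comp M b [u] = v"
    using preuniversal_factor[OF u, of v "Cod M v"] A D by (auto simp: hom_iff)
  obtain c where c: "c \<in> hom M [Cod M v] (Cod M u)" "Comp M c [v] = u"
    using preuniversal_factor[OF v, of u "Cod M u"] A D by (auto simp: hom_iff)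
  \<comment> \<open>Stated for fresh variables because it serves twice, the second time with the
    roles of \<open>u\<close> and \<open>v\<close> exchanged.\<close>
  have inv: "Comp M c [b] = Idt M (Cod M u)"
    if u: "preuniversal M u" and b: "b \<in> hom M [Cod M u] (Cod M v)" "Comp M b [u] = v"
      and c: "c \<in> hom M [Cod M v] (Cod M u)" "Comp M c [v] = u" for b c u v
  proof (rule preuniversal_cancel[OF u])
    have uA: "u \<in> Arr M" using u by (simp add: preuniversal_def)
    have cb: "composable M c [b]" and bu: "composable M b [u]"
      using b c uA by (simp_all add: composable_def hom_iff)
    show "Comp M c [b] \<in> hom M [Cod M u] (Cod M u)"
      using cb b c by (simp add: hom_iff Comp_Arr Dom_Comp Cod_Comp)
    show "Idt M (Cod M u) \<in> hom M [Cod M u] (Cod M u)" using uA by (intro Idt_hom Cod_Obj)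
    show "Comp M (Comp M c [b]) [u] = Comp M (Idt M (Cod M u)) [u]"
      using b c uA by (simp add: Comp_assoc_single[OF cb bu] Comp_Idt_left)
  qed
  show ?thesis using that[OF b(1) c(1) b(2)] inv[OF u b c] inv[OF v c b] .
qed

text \<open>
  With \<open>v\<close> preuniversal on the codomains of \<open>us\<close>, composition with \<open>v\<close> and composition with the
  preuniversal arrow \<open>v(us)\<close> are both bijective, and the latter factors through the former.
\<close>

lemma bij_betw_Comp_preuniversals:
  assumes rep: "representable M" and us: "\<And>u. u \<in> set us \<Longrightarrow> preuniversal M u" and B: "B \<in> Obj M"
  shows "bij_betw (\<lambda>g. Comp M g us) (hom M (map (Cod M) us) B) (hom M (concat (map (Dom M) us)) B)"
proof -
  have usA: "set us \<subseteq> Arr M" using us by (auto simp: preuniversal_def)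
  then have "set (map (Cod M) us) \<subseteq> Obj M" using Cod_Obj by auto
  then obtain v where v: "preuniversal M v" "Dom M v = map (Cod M) us"
    using rep unfolding representable_def by blast
  have vA: "v \<in> Arr M" using v by (simp add: preuniversal_def)
  have vus: "composable M v us" using vA usA v by (simp add: composable_def)
  have "preuniversal M (Comp M v us)"
    using rep v us vus unfolding representable_def by blast
  then have "bij_betw (\<lambda>g. Comp M g [Comp M v us]) (hom M [Cod M v] B) (hom M (concat (map (Dom M) us)) B)"
    using B by (simp add: preuniversal_def Dom_Comp[OF vus] Cod_Comp[OF vus])
  moreover have "Comp M g [Comp M v us] = ((\<lambda>g. Comp M g us) \<circ> (\<lambda>g. Comp M g [v])) g"
    if "g \<in> hom M [Cod M v] B" for g
    using that vA vus by (simp add: Comp_assoc_single composable_def hom_iff)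
  ultimately have "bij_betw ((\<lambda>g. Comp M g us) \<circ> (\<lambda>g. Comp M g [v])) (hom M [Cod M v] B)
      (hom M (concat (map (Dom M) us)) B)"
    by (subst (asm) bij_betw_cong)
  moreover have "bij_betw (\<lambda>g. Comp M g [v]) (hom M [Cod M v] B) (hom M (map (Cod M) us) B)"
    using v B by (simp add: preuniversal_def)
  ultimately show ?thesis by (simp add: bij_betw_comp_iff)
qed

end

section \<open>Symmetric action and composition\<close>

lemma (in symmetric_multicategory) Act_Arr:
  "f \<in> Arr M \<Longrightarrow> \<sigma> permutes {..<length (Dom M f)} \<Longrightarrow> Act M \<sigma> f \<in> Arr M"
  and Dom_Act: "f \<in> Arr M \<Longrightarrow> \<sigma> permutes {..<length (Dom M f)} \<Longrightarrow>
    Dom M (Act M \<sigma> f) = permute_list \<sigma> (Dom M f)"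
  and Cod_Act: "f \<in> Arr M \<Longrightarrow> \<sigma> permutes {..<length (Dom M f)} \<Longrightarrow> Cod M (Act M \<sigma> f) = Cod M f"
  using Act_hom[of f \<sigma>] by (simp_all add: hom_iff)

lemma (in symmetric_multicategory) Comp_Act_inner_map:
  assumes "composable M f (map g xs)" "\<And>x. x \<in> set xs \<Longrightarrow> \<sigma> x permutes {..<length (Dom M (g x))}"
  shows "Comp M f (map (\<lambda>x. Act M (\<sigma> x) (g x)) xs)
    = Act M (juxtapose_perms (map \<sigma> xs) (map (\<lambda>x. length (Dom M (g x))) xs)) (Comp M f (map g xs))"
proof -
  have "map2 (Act M) (map \<sigma> xs) (map g xs) = map (\<lambda>x. Act M (\<sigma> x) (g x)) xs"
    by (induction xs) simp_all
  moreover have "list_all2 (\<lambda>\<sigma> g. \<sigma> permutes {..<length (Dom M g)}) (map \<sigma> xs) (map g xs)"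
    using assms(2) by (simp add: list.rel_map list_all2_same)
  from Comp_Act_inner[OF assms(1) this]
  have "Comp M f (map2 (Act M) (map \<sigma> xs) (map g xs))
    = Act M (juxtapose_perms (map \<sigma> xs) (map (\<lambda>x. length (Dom M (g x))) xs)) (Comp M f (map g xs))"
    by (simp only: map_map comp_def)
  ultimately show ?thesis by (simp only:)
qed

lemma (in symmetric_multicategory) Comp_Act_inner_single:
  assumes "composable M f [g]" "\<sigma> permutes {..<length (Dom M g)}"
  shows "Comp M f [Act M \<sigma> g] = Act M \<sigma> (Comp M f [g])"
  using Comp_Act_inner_map[of f "\<lambda>_. g" "[()]" "\<lambda>_. \<sigma>"] assms
  by (simp add: juxtapose_perms_singleton)

section \<open>The multicategory structure on symmetric functors\<close>

lemma functor_multicat_simps [simp]: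
  "Dom (functor_multicat M N) = src"
  "Cod (functor_multicat M N) = tgt"
  "F \<in> Obj (functor_multicat M N) \<longleftrightarrow> symmetric_functor M N F"
  "src (Comp (functor_multicat M N) \<alpha> \<beta>s) = concat (map src \<beta>s)"
  "tgt (Comp (functor_multicat M N) \<alpha> \<beta>s) = tgt \<alpha>"
  "src (Idt (functor_multicat M N) F) = [F]"
  "tgt (Idt (functor_multicat M N) F) = F"
  by (simp_all add: functor_multicat_def)

lemma component_Comp [simp]:
  "A \<in> Obj M \<Longrightarrow> component (Comp (functor_multicat M N) \<alpha> \<beta>s) A
    = Comp N (component \<alpha> A) (map (\<lambda>\<beta>. component \<beta> A) \<beta>s)"
  by (simp add: functor_multicat_def)

lemma component_Idt [simp]:
  "A \<in> Obj M \<Longrightarrow> component (Idt (functor_multicat M N) F) A = Idt N (on_obj F A)"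
  by (simp add: functor_multicat_def)

locale functors = M: symmetric_multicategory M + N: symmetric_multicategory N
  for M :: "('o, 'a) multicat" and N :: "('p, 'b) multicat"
begin

lemma functor_Obj: "symmetric_functor M N F \<Longrightarrow> A \<in> Obj M \<Longrightarrow> on_obj F A \<in> Obj N"
  by (auto simp: symmetric_functor_def)

lemma functor_Arr: "symmetric_functor M N F \<Longrightarrow> f \<in> Arr M \<Longrightarrow> on_arr F f \<in> Arr N"
  and Dom_functor: "symmetric_functor M N F \<Longrightarrow> f \<in> Arr M \<Longrightarrow>
    Dom N (on_arr F f) = map (on_obj F) (Dom M f)"
  and Cod_functor: "symmetric_functor M N F \<Longrightarrow> f \<in> Arr M \<Longrightarrow>
    Cod N (on_arr F f) = on_obj F (Cod M f)"
  by (auto simp: symmetric_functor_def hom_iff)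

lemma functor_Idt: "symmetric_functor M N F \<Longrightarrow> A \<in> Obj M \<Longrightarrow> on_arr F (Idt M A) = Idt N (on_obj F A)"
  and functor_Comp: "symmetric_functor M N F \<Longrightarrow> composable M f gs \<Longrightarrow>
    on_arr F (Comp M f gs) = Comp N (on_arr F f) (map (on_arr F) gs)"
  and functor_Act: "symmetric_functor M N F \<Longrightarrow> f \<in> Arr M \<Longrightarrow> \<sigma> permutes {..<length (Dom M f)} \<Longrightarrow>
    on_arr F (Act M \<sigma> f) = Act N \<sigma> (on_arr F f)"
  by (simp_all add: symmetric_functor_def)

lemma trans_iff:
  "\<alpha> \<in> Arr (functor_multicat M N) \<longleftrightarrow>
    (\<forall>F \<in> set (src \<alpha>). symmetric_functor M N F) \<and> symmetric_functor M N (tgt \<alpha>) \<and>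
    component \<alpha> \<in> extensional (Obj M) \<and>
    (\<forall>A \<in> Obj M. component \<alpha> A \<in> hom N (map (\<lambda>F. on_obj F A) (src \<alpha>)) (on_obj (tgt \<alpha>) A)) \<and>
    natural M N \<alpha>"
  by (simp add: functor_multicat_def)

lemma functor_src: "\<alpha> \<in> Arr (functor_multicat M N) \<Longrightarrow> F \<in> set (src \<alpha>) \<Longrightarrow> symmetric_functor M N F"
  and functor_tgt: "\<alpha> \<in> Arr (functor_multicat M N) \<Longrightarrow> symmetric_functor M N (tgt \<alpha>)"
  by (simp_all add: trans_iff)

lemma component_Arr: "\<alpha> \<in> Arr (functor_multicat M N) \<Longrightarrow> A \<in> Obj M \<Longrightarrow> component \<alpha> A \<in> Arr N"
  and Dom_component: "\<alpha> \<in> Arr (functor_multicat M N) \<Longrightarrow> A \<in> Obj M \<Longrightarrow>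
    Dom N (component \<alpha> A) = map (\<lambda>F. on_obj F A) (src \<alpha>)"
  and Cod_component: "\<alpha> \<in> Arr (functor_multicat M N) \<Longrightarrow> A \<in> Obj M \<Longrightarrow>
    Cod N (component \<alpha> A) = on_obj (tgt \<alpha>) A"
  by (simp_all add: trans_iff hom_iff)

lemma naturality: "\<alpha> \<in> Arr (functor_multicat M N) \<Longrightarrow> f \<in> Arr M \<Longrightarrow>
    Comp N (on_arr (tgt \<alpha>) f) (map (component \<alpha>) (Dom M f))
      = Act N (exchange_perm (length (Dom M f)) (length (src \<alpha>)))
          (Comp N (component \<alpha> (Cod M f)) (map (\<lambda>F. on_arr F f) (src \<alpha>)))"
  by (simp add: trans_iff natural_def)

text \<open>Component maps are extensional, so agreement on the objects of \<open>M\<close> already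
  makes them equal as functions.\<close>

lemma trans_eqI:
  assumes "\<alpha> \<in> Arr (functor_multicat M N)" "\<beta> \<in> Arr (functor_multicat M N)"
    "src \<alpha> = src \<beta>" "tgt \<alpha> = tgt \<beta>" "\<And>A. A \<in> Obj M \<Longrightarrow> component \<alpha> A = component \<beta> A"
  shows "\<alpha> = \<beta>"
proof -
  have "component \<alpha> = component \<beta>"
    using assms by (intro extensionalityI[of _ "Obj M"]) (auto simp: trans_iff)
  then show ?thesis using assms by (simp add: mtrans.expand)
qed

lemma composable_component:
  assumes c: "composable (functor_multicat M N) \<alpha> \<beta>s" and A: "A \<in> Obj M"
  shows "composable N (component \<alpha> A) (map (\<lambda>\<beta>. component \<beta> A) \<beta>s)"
proof (rule composableI)
  have \<alpha>: "\<alpha> \<in> Arr (functor_multicat M N)" and \<beta>: "\<And>\<beta>. \<beta> \<in> set \<beta>s \<Longrightarrow> \<beta> \<in> Arr (functor_multicat M N)"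
    and src: "src \<alpha> = map tgt \<beta>s"
    using c by (auto simp: composable_def)
  show "component \<alpha> A \<in> Arr N" using \<alpha> A by (rule component_Arr)
  show "g \<in> Arr N" if "g \<in> set (map (\<lambda>\<beta>. component \<beta> A) \<beta>s)" for g
    using that \<beta> A by (auto simp: component_Arr)
  show "map (Cod N) (map (\<lambda>\<beta>. component \<beta> A) \<beta>s) = Dom N (component \<alpha> A)"
    using \<alpha> \<beta> A by (simp add: Cod_component Dom_component src)
qed

lemma composable_functors:
  assumes "\<And>F. F \<in> set Fs \<Longrightarrow> symmetric_functor M N F" "f \<in> Arr M"
    and "h \<in> Arr N" "Dom N h = map (\<lambda>F. on_obj F (Cod M f)) Fs"
  shows "composable N h (map (\<lambda>F. on_arr F f) Fs)"
  using assms by (intro composableI) (auto simp: Cod_functor intro: functor_Arr)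

lemma composable_functor_components:
  assumes "symmetric_functor M N F" "f \<in> Arr M"
    and "\<And>A. A \<in> Obj M \<Longrightarrow> a A \<in> Arr N" "\<And>A. A \<in> Obj M \<Longrightarrow> Cod N (a A) = on_obj F A"
  shows "composable N (on_arr F f) (map a (Dom M f))"
  using assms M.Dom_Obj[OF assms(2)]
  by (intro composableI) (auto simp: functor_Arr Dom_functor)

text \<open>Naturality of \<open>\<alpha>\<close> moves its target functor past the components of
  \<open>\<alpha>\<close>, and naturality of each \<open>\<beta>\<close> does the same one level
  further in. The outer exchange comes out as a block permutation, the inner ones as a
  juxtaposition, and \<open>exchange_perm_sum_list_right\<close> merges the two into the exchange
  for the concatenated domain.\<close>

lemma natural_Comp:
  assumes c: "composable (functor_multicat M N) \<alpha> \<beta>s"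
  shows "natural M N (Comp (functor_multicat M N) \<alpha> \<beta>s)"
  unfolding natural_def
proof
  fix f assume f: "f \<in> Arr M"
  define As A m n where "As = Dom M f" and "A = Cod M f" and "m = length As" and "n = length \<beta>s"
  have As: "B \<in> Obj M" if "B \<in> set As" for B using M.Dom_Obj[OF f] that by (auto simp: As_def)
  have A: "A \<in> Obj M" using f by (simp add: A_def M.Cod_Obj)
  have \<alpha>: "\<alpha> \<in> Arr (functor_multicat M N)" and \<beta>: "\<And>\<beta>. \<beta> \<in> set \<beta>s \<Longrightarrow> \<beta> \<in> Arr (functor_multicat M N)"
    and src: "src \<alpha> = map tgt \<beta>s"
    using c by (auto simp: composable_def)
  define ks where "ks = map (\<lambda>\<beta>. length (src \<beta>)) \<beta>s"
  \<comment> \<open>\<open>X\<close>, \<open>Y \<beta>\<close> and \<open>Z\<close> are the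
    right-hand sides of naturality for \<open>\<alpha>\<close>, for \<open>\<beta>\<close> and for
    the composite, each before reordering. The list \<open>hs\<close> runs through the
    transformations outside and the objects inside, as the domain of \<open>X\<close> does.\<close>
  define X where "X = Comp N (component \<alpha> A) (map (\<lambda>\<beta>. on_arr (tgt \<beta>) f) \<beta>s)"
  define Y where "Y \<beta> = Comp N (component \<beta> A) (map (\<lambda>G. on_arr G f) (src \<beta>))" for \<beta> :: "('o, 'a, 'p, 'b) mtrans"
  define Z where "Z = Comp N (Comp N (component \<alpha> A) (map (\<lambda>\<beta>. component \<beta> A) \<beta>s))
    (map (\<lambda>G. on_arr G f) (concat (map src \<beta>s)))"
  define hs where "hs = concat (map (\<lambda>\<beta>. map (component \<beta>) As) \<beta>s)"
  have cX: "composable N (component \<alpha> A) (map (\<lambda>\<beta>. on_arr (tgt \<beta>) f) \<beta>s)"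
    using composable_functors[OF functor_src[OF \<alpha>] f, of "src \<alpha>" "component \<alpha> A"] \<alpha> A
    by (simp add: src component_Arr Dom_component comp_def A_def)
  have cY: "composable N (component \<beta> A) (map (\<lambda>G. on_arr G f) (src \<beta>))" if "\<beta> \<in> set \<beta>s" for \<beta>
    using composable_functors[OF functor_src[OF \<beta>[OF that]] f, of "src \<beta>" "component \<beta> A"] \<beta>[OF that] A
    by (simp add: component_Arr Dom_component A_def)
  have cYc: "composable N (on_arr (tgt \<beta>) f) (map (component \<beta>) As)" if "\<beta> \<in> set \<beta>s" for \<beta>
    unfolding As_def using \<beta>[OF that] f
    by (intro composable_functor_components functor_tgt) (auto simp: component_Arr Cod_component)
  have cA: "composable N (component \<alpha> A) (map (\<lambda>\<beta>. component \<beta> A) \<beta>s)"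
    using composable_component[OF c A] .
  have cAY: "composable N (component \<alpha> A) (map Y \<beta>s)"
    using cA cY by (auto simp: composable_def Y_def N.Comp_Arr N.Cod_Comp cong: map_cong)
  have cXh: "composable N X hs"
    using cX cYc by (auto simp: composable_def X_def hs_def N.Comp_Arr N.Dom_Comp map_concat comp_def
        intro!: arg_cong[of _ _ concat])
  have XA: "X \<in> Arr N" using cX by (simp add: X_def N.Comp_Arr)
  have DX: "length (Dom N X) = m * n"
    using cX f \<beta> by (simp add: X_def N.Dom_Comp length_concat comp_def Dom_functor functor_tgt
        m_def n_def As_def sum_list_triv cong: map_cong)
  have DY: "length (Dom N (Y \<beta>)) = length (src \<beta>) * m" if "\<beta> \<in> set \<beta>s" for \<beta>
    using cY[OF that] f functor_src[OF \<beta>[OF that]]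
    by (simp add: Y_def N.Dom_Comp length_concat comp_def Dom_functor
        m_def As_def sum_list_triv cong: map_cong)
  have lhs: "map (\<lambda>g. length (Dom N g)) hs = concat (map (\<lambda>k. replicate m k) ks)"
    using \<beta> As by (simp add: hs_def ks_def map_concat comp_def Dom_component m_def
        map_replicate_const cong: map_cong)
  have lh: "length hs = m * n" by (simp add: hs_def m_def n_def length_concat_grid mult.commute)
  let ?b = "block_perm (exchange_perm m n) (concat (map (\<lambda>k. replicate m k) ks))"
  let ?j = "juxtapose_perms (map (\<lambda>k. exchange_perm m k) ks) (map (\<lambda>k. k * m) ks)"
  have AY: "Comp N (component \<alpha> A) (map Y \<beta>s) = Z"
    unfolding Y_def Z_def using N.Comp_assoc_map[OF cA cY] by (simp add: map_concat comp_def)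
  have DZ: "length (Dom N Z) = m * sum_list ks" and ZA: "Z \<in> Arr N"
    using cAY DY by (simp_all flip: AY add: N.Comp_Arr N.Dom_Comp length_concat comp_def ks_def
      sum_list_mult_const mult.commute[of m] cong: map_cong)
  have "Comp N X hs
      = Comp N (component \<alpha> A) (map (\<lambda>\<beta>. Comp N (on_arr (tgt \<beta>) f) (map (component \<beta>) As)) \<beta>s)"
    unfolding X_def hs_def by (rule N.Comp_assoc_map[OF cX cYc])
  also have "\<dots> = Comp N (component \<alpha> A) (map (\<lambda>\<beta>. Act N (exchange_perm m (length (src \<beta>))) (Y \<beta>)) \<beta>s)"
    using naturality[OF \<beta> f] by (simp add: Y_def As_def A_def m_def cong: map_cong)
  also have "\<dots> = Act N ?j Z"
    using N.Comp_Act_inner_map[OF cAY, of "\<lambda>\<beta>. exchange_perm m (length (src \<beta>))"] DY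
    by (simp add: exchange_perm_permutes' AY ks_def comp_def cong: map_cong)
  finally have Xhs: "Comp N X hs = Act N ?j Z" .
  have "Comp N (on_arr (tgt \<alpha>) f) (map (component (Comp (functor_multicat M N) \<alpha> \<beta>s)) As)
      = Comp N (on_arr (tgt \<alpha>) f) (map (\<lambda>B. Comp N (component \<alpha> B) (map (\<lambda>\<beta>. component \<beta> B) \<beta>s)) As)"
    using As by (simp cong: map_cong)
  also have "\<dots> = Comp N (Comp N (on_arr (tgt \<alpha>) f) (map (component \<alpha>) As))
      (concat (map (\<lambda>B. map (\<lambda>\<beta>. component \<beta> B) \<beta>s) As))"
    using \<alpha> f As composable_component[OF c] unfolding As_def
    by (intro N.Comp_assoc_map[symmetric] composable_functor_components functor_tgt)
      (auto simp: component_Arr Cod_component)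
  also have "Comp N (on_arr (tgt \<alpha>) f) (map (component \<alpha>) As) = Act N (exchange_perm m n) X"
    using naturality[OF \<alpha> f] by (simp add: src X_def As_def A_def m_def n_def comp_def)
  \<comment> \<open>With the objects outside, the components are \<open>hs\<close> reordered by the
    very permutation that naturality of \<open>\<alpha>\<close> has left on \<open>X\<close>, so
    equivariance in the outer arrow applies.\<close>
  also have "concat (map (\<lambda>B. map (\<lambda>\<beta>. component \<beta> B) \<beta>s) As) = permute_list (exchange_perm m n) hs"
    unfolding m_def n_def hs_def by (rule permute_list_exchange_perm[symmetric])
  also have "Comp N (Act N (exchange_perm m n) X) (permute_list (exchange_perm m n) hs)
      = Act N ?b (Comp N X hs)"
    using N.Comp_Act_outer[OF cXh] by (simp add: lh exchange_perm_permutes lhs)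
  also have "\<dots> = Act N (?j \<circ> ?b) Z"
    unfolding Xhs
  proof (rule N.Act_comp[symmetric, OF ZA])
    show "?j permutes {..<length (Dom N Z)}"
      using juxtapose_perms_permutes[of "map (\<lambda>k. exchange_perm m k) ks" "map (\<lambda>k. k * m) ks"]
      by (simp add: DZ list_all2_conv_all_nth exchange_perm_permutes'
          sum_list_mult_const[of id, simplified] mult.commute[of m])
    show "?b permutes {..<length (Dom N Z)}"
    proof -
      have "length (concat (map (\<lambda>k. replicate m k) ks)) = m * n"
        by (simp add: length_concat comp_def sum_list_triv ks_def n_def)
      then show ?thesis
        using block_perm_permutes[of "exchange_perm m n" "concat (map (\<lambda>k. replicate m k) ks)"]
        by (simp add: DZ sum_list_concat_map_replicate exchange_perm_permutes)
    qed
  qed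
  also have "?j \<circ> ?b = exchange_perm m (sum_list ks)"
    using exchange_perm_sum_list_right[of m ks] by (simp add: ks_def n_def)
  also have "sum_list ks = length (concat (map src \<beta>s))"
    by (simp add: ks_def length_concat comp_def)
  finally show "Comp N (on_arr (tgt (Comp (functor_multicat M N) \<alpha> \<beta>s)) f)
      (map (component (Comp (functor_multicat M N) \<alpha> \<beta>s)) (Dom M f))
    = Act N (exchange_perm (length (Dom M f)) (length (src (Comp (functor_multicat M N) \<alpha> \<beta>s))))
      (Comp N (component (Comp (functor_multicat M N) \<alpha> \<beta>s) (Cod M f))
        (map (\<lambda>F. on_arr F f) (src (Comp (functor_multicat M N) \<alpha> \<beta>s))))"
    using A by (simp add: Z_def As_def A_def m_def)
qed

lemma Comp_trans:
  assumes c: "composable (functor_multicat M N) \<alpha> \<beta>s"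
  shows "Comp (functor_multicat M N) \<alpha> \<beta>s \<in> Arr (functor_multicat M N)"
proof -
  have \<alpha>: "\<alpha> \<in> Arr (functor_multicat M N)" and \<beta>: "\<And>\<beta>. \<beta> \<in> set \<beta>s \<Longrightarrow> \<beta> \<in> Arr (functor_multicat M N)"
    using c by (auto simp: composable_def)
  have "component (Comp (functor_multicat M N) \<alpha> \<beta>s) A
      \<in> hom N (map (\<lambda>F. on_obj F A) (concat (map src \<beta>s))) (on_obj (tgt \<alpha>) A)" if A: "A \<in> Obj M" for A
  proof -
    have "map (Dom N) (map (\<lambda>\<beta>. component \<beta> A) \<beta>s) = map (\<lambda>\<beta>. map (\<lambda>F. on_obj F A) (src \<beta>)) \<beta>s"
      using A \<beta> by (auto simp: Dom_component)
    note hom = N.Comp_hom[OF composable_component[OF c A], unfolded this]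
    then show ?thesis
      using A \<alpha> by (simp add: Cod_component map_concat comp_def)
  qed
  moreover have "component (Comp (functor_multicat M N) \<alpha> \<beta>s) \<in> extensional (Obj M)"
    by (simp add: functor_multicat_def)
  ultimately show ?thesis
    unfolding trans_iff using natural_Comp[OF c] \<alpha> \<beta> by (auto dest: functor_src functor_tgt)
qed

lemma Idt_trans:
  assumes F: "symmetric_functor M N F"
  shows "Idt (functor_multicat M N) F \<in> Arr (functor_multicat M N)"
proof -
  have "natural M N (Idt (functor_multicat M N) F)"
    unfolding natural_def
  proof
    fix f assume f: "f \<in> Arr M"
    have "map (component (Idt (functor_multicat M N) F)) (Dom M f) = map (Idt N) (Dom N (on_arr F f))"
      using M.Dom_Obj[OF f] F f by (auto simp: Dom_functor)
    then show "Comp N (on_arr (tgt (Idt (functor_multicat M N) F)) f)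
        (map (component (Idt (functor_multicat M N) F)) (Dom M f))
      = Act N (exchange_perm (length (Dom M f)) (length (src (Idt (functor_multicat M N) F))))
        (Comp N (component (Idt (functor_multicat M N) F) (Cod M f))
          (map (\<lambda>F. on_arr F f) (src (Idt (functor_multicat M N) F))))"
      using F f N.Comp_Idt_left[of "on_arr F f"]
      by (simp add: N.Comp_Idt_right functor_Arr M.Cod_Obj Cod_functor N.Act_id)
  qed
  moreover have "component (Idt (functor_multicat M N) F) \<in> extensional (Obj M)"
    by (simp add: functor_multicat_def)
  ultimately show ?thesis
    using F by (simp add: trans_iff functor_Obj N.Idt_hom)
qed

text \<open>Domains are concatenated and components are computed in \<open>N\<close>, so each law
  holds component by component once composites and identities are known to be natural. The
  interpretation also makes the results on preuniversal arrows available for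
  transformations.\<close>

sublocale FM: multicategory "functor_multicat M N"
proof
  show "set (Dom (functor_multicat M N) \<alpha>) \<subseteq> Obj (functor_multicat M N)"
    and "Cod (functor_multicat M N) \<alpha> \<in> Obj (functor_multicat M N)"
    if "\<alpha> \<in> Arr (functor_multicat M N)" for \<alpha>
    using that by (auto simp: functor_src functor_tgt)
  show "Idt (functor_multicat M N) F \<in> hom (functor_multicat M N) [F] F"
    if "F \<in> Obj (functor_multicat M N)" for F
    using that by (simp add: hom_iff Idt_trans)
  show "Comp (functor_multicat M N) \<alpha> \<beta>s
      \<in> hom (functor_multicat M N) (concat (map (Dom (functor_multicat M N)) \<beta>s)) (Cod (functor_multicat M N) \<alpha>)"
    if "composable (functor_multicat M N) \<alpha> \<beta>s" for \<alpha> \<beta>s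
    using that by (simp add: hom_iff Comp_trans cong: map_cong)
  show "Comp (functor_multicat M N) (Idt (functor_multicat M N) (Cod (functor_multicat M N) \<alpha>)) [\<alpha>] = \<alpha>"
    if \<alpha>: "\<alpha> \<in> Arr (functor_multicat M N)" for \<alpha>
  proof (rule trans_eqI[OF Comp_trans \<alpha>])
    show "composable (functor_multicat M N)
        (Idt (functor_multicat M N) (Cod (functor_multicat M N) \<alpha>)) [\<alpha>]"
      using \<alpha> by (simp add: composable_def Idt_trans functor_tgt)
  qed (use \<alpha> N.Comp_Idt_left[OF component_Arr[OF \<alpha>]] in \<open>simp_all add: Cod_component\<close>)
  show "Comp (functor_multicat M N) \<alpha>
      (map (Idt (functor_multicat M N)) (Dom (functor_multicat M N) \<alpha>)) = \<alpha>"
    if \<alpha>: "\<alpha> \<in> Arr (functor_multicat M N)" for \<alpha>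
  proof (rule trans_eqI[OF Comp_trans \<alpha>])
    show "composable (functor_multicat M N) \<alpha>
        (map (Idt (functor_multicat M N)) (Dom (functor_multicat M N) \<alpha>))"
      using \<alpha> by (auto simp: composable_def comp_def intro!: Idt_trans dest: functor_src)
    show "component (Comp (functor_multicat M N) \<alpha>
        (map (Idt (functor_multicat M N)) (Dom (functor_multicat M N) \<alpha>))) A = component \<alpha> A"
      if "A \<in> Obj M" for A
      using that \<alpha> N.Comp_Idt_right[OF component_Arr[OF \<alpha> that]] by (simp add: Dom_component comp_def)
  qed (use \<alpha> in \<open>simp_all add: comp_def\<close>)
  show "Comp (functor_multicat M N) (Comp (functor_multicat M N) \<alpha> \<beta>s) (concat \<gamma>ss)
      = Comp (functor_multicat M N) \<alpha> (map2 (Comp (functor_multicat M N)) \<beta>s \<gamma>ss)"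
    if c: "composable (functor_multicat M N) \<alpha> \<beta>s"
      and c': "list_all2 (composable (functor_multicat M N)) \<beta>s \<gamma>ss" for \<alpha> \<beta>s \<gamma>ss
  proof (rule trans_eqI)
    have src: "concat (map src \<beta>s) = map tgt (concat \<gamma>ss)"
      using c' by (induction rule: list_all2_induct) (simp_all add: composable_def)
    have tgt: "map tgt (map2 (Comp (functor_multicat M N)) \<beta>s \<gamma>ss) = map tgt \<beta>s"
      using c' by (induction rule: list_all2_induct) simp_all
    have Arr: "set (concat \<gamma>ss) \<subseteq> Arr (functor_multicat M N)"
      "set (map2 (Comp (functor_multicat M N)) \<beta>s \<gamma>ss) \<subseteq> Arr (functor_multicat M N)"
      using c' by (induction rule: list_all2_induct) (auto simp: composable_def intro!: Comp_trans)
    show "Comp (functor_multicat M N) (Comp (functor_multicat M N) \<alpha> \<beta>s) (concat \<gamma>ss)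
        \<in> Arr (functor_multicat M N)"
      using c Arr src by (intro Comp_trans) (simp add: composable_def Comp_trans[OF c])
    show "Comp (functor_multicat M N) \<alpha> (map2 (Comp (functor_multicat M N)) \<beta>s \<gamma>ss)
        \<in> Arr (functor_multicat M N)"
      using c Arr tgt by (intro Comp_trans) (simp add: composable_def)
    show "src (Comp (functor_multicat M N) (Comp (functor_multicat M N) \<alpha> \<beta>s) (concat \<gamma>ss))
        = src (Comp (functor_multicat M N) \<alpha> (map2 (Comp (functor_multicat M N)) \<beta>s \<gamma>ss))"
      using c' by simp (induction rule: list_all2_induct, simp_all)
    fix A assume A: "A \<in> Obj M"
    have "list_all2 (composable N) (map (\<lambda>\<beta>. component \<beta> A) \<beta>s) (map (map (\<lambda>\<beta>. component \<beta> A)) \<gamma>ss)"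
      using c' A by (induction rule: list_all2_induct) (simp_all add: composable_component)
    note assoc = N.Comp_assoc[OF composable_component[OF c A] this]
    have "map2 (Comp N) (map (\<lambda>\<beta>. component \<beta> A) \<beta>s) (map (map (\<lambda>\<beta>. component \<beta> A)) \<gamma>ss)
        = map (\<lambda>\<beta>. component \<beta> A) (map2 (Comp (functor_multicat M N)) \<beta>s \<gamma>ss)"
      using c' A by (induction rule: list_all2_induct) simp_all
    with assoc show "component (Comp (functor_multicat M N) (Comp (functor_multicat M N) \<alpha> \<beta>s) (concat \<gamma>ss)) A
        = component (Comp (functor_multicat M N) \<alpha> (map2 (Comp (functor_multicat M N)) \<beta>s \<gamma>ss)) A"
      using A by (simp add: map_concat)
  qed simp
qed

end

section \<open>Pointwise tensor products of functors\<close>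

text \<open>No compatibility is imposed between the arrows \<open>u A\<close> at different objects;
  the tensor functor acts on arrows in the one way that makes them natural.\<close>

locale tensor_product = functors M N
  for M :: "('o, 'a) multicat" and N :: "('p, 'b) multicat" +
  fixes Fs :: "('o, 'a, 'p, 'b) mfunctor list" and u :: "'o \<Rightarrow> 'b"
  assumes rep: "representable N"
    and Fs: "F \<in> set Fs \<Longrightarrow> symmetric_functor M N F"
    and u: "A \<in> Obj M \<Longrightarrow> preuniversal N (u A)"
    and Dom_u: "A \<in> Obj M \<Longrightarrow> Dom N (u A) = map (\<lambda>F. on_obj F A) Fs"
begin

text \<open>The right-hand side of the naturality condition for \<open>u\<close> at
  \<open>f\<close>. After the exchange its inputs are grouped by the objects in
  \<open>Dom M f\<close>, so its domain is the concatenation of the domains of the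
  \<open>u A\<close>, as a factorization through them requires.\<close>

definition exchanged :: "'a \<Rightarrow> 'b" where
  "exchanged f = Act N (exchange_perm (length (Dom M f)) (length Fs))
    (Comp N (u (Cod M f)) (map (\<lambda>F. on_arr F f) Fs))"

text \<open>The naturality equation is read as an equation for the unknown \<open>h\<close>;
  \<open>tensor_arr_unique\<close> shows that the definite description is meaningful for every arrow
  of \<open>M\<close>.\<close>

definition tensor_arr :: "'a \<Rightarrow> 'b" where
  "tensor_arr f = (THE h. h \<in> hom N (map (\<lambda>A. Cod N (u A)) (Dom M f)) (Cod N (u (Cod M f))) \<and>
    Comp N h (map u (Dom M f)) = exchanged f)"

definition tensor_functor :: "('o, 'a, 'p, 'b) mfunctor" where
  "tensor_functor = MFunctor (\<lambda>A \<in> Obj M. Cod N (u A)) (\<lambda>f \<in> Arr M. tensor_arr f)"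

lemma u_Arr: "A \<in> Obj M \<Longrightarrow> u A \<in> Arr N"
  using u by (simp add: preuniversal_def)

lemma bij_betw_Comp_u:
  assumes "set As \<subseteq> Obj M" "B \<in> Obj N"
  shows "bij_betw (\<lambda>h. Comp N h (map u As)) (hom N (map (\<lambda>A. Cod N (u A)) As) B)
    (hom N (concat (map (\<lambda>A. Dom N (u A)) As)) B)"
  using N.bij_betw_Comp_preuniversals[OF rep _ assms(2), of "map u As"] assms(1) u
  by (auto simp: comp_def)

text \<open>The means by which every law for \<open>tensor_arr\<close> is proved: both sides have
  the same type, and they are compared after composition with the arrows \<open>u\<close>, where the
  defining equation can be used.\<close>

lemma Comp_u_cancel:
  assumes "set As \<subseteq> Obj M" "h \<in> hom N (map (\<lambda>A. Cod N (u A)) As) B"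
    "h' \<in> hom N (map (\<lambda>A. Cod N (u A)) As) B" "Comp N h (map u As) = Comp N h' (map u As)"
  shows "h = h'"
proof -
  have "B \<in> Obj N" using assms(2) N.Cod_Obj by (auto simp: hom_iff)
  from bij_betw_Comp_u[OF assms(1) this] show ?thesis
    using assms by (auto simp: bij_betw_def inj_on_def)
qed

lemma composable_u_functors:
  "f \<in> Arr M \<Longrightarrow> composable N (u (Cod M f)) (map (\<lambda>F. on_arr F f) Fs)"
  by (intro composable_functors Fs) (simp_all add: u_Arr M.Cod_Obj Dom_u)

lemma length_Dom_u_functors:
  "f \<in> Arr M \<Longrightarrow> length (Dom N (Comp N (u (Cod M f)) (map (\<lambda>F. on_arr F f) Fs)))
    = length (Dom M f) * length Fs"
  using Fs by (simp add: N.Dom_Comp composable_u_functors length_concat comp_def Dom_functor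
      sum_list_triv cong: map_cong)

lemma exchanged_hom:
  assumes f: "f \<in> Arr M"
  shows "exchanged f \<in> hom N (concat (map (\<lambda>A. Dom N (u A)) (Dom M f))) (Cod N (u (Cod M f)))"
proof -
  let ?X = "Comp N (u (Cod M f)) (map (\<lambda>F. on_arr F f) Fs)"
  have c: "composable N (u (Cod M f)) (map (\<lambda>F. on_arr F f) Fs)"
    using f by (rule composable_u_functors)
  have "Dom N ?X = concat (map (\<lambda>F. map (\<lambda>A. on_obj F A) (Dom M f)) Fs)"
    using Fs f by (simp add: N.Dom_Comp[OF c] comp_def Dom_functor cong: map_cong)
  then have "permute_list (exchange_perm (length (Dom M f)) (length Fs)) (Dom N ?X)
      = concat (map (\<lambda>A. map (\<lambda>F. on_obj F A) Fs) (Dom M f))"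
    by (simp add: permute_list_exchange_perm)
  also have "map (\<lambda>A. map (\<lambda>F. on_obj F A) Fs) (Dom M f) = map (\<lambda>A. Dom N (u A)) (Dom M f)"
    using M.Dom_Obj[OF f] by (auto simp: Dom_u)
  finally have "permute_list (exchange_perm (length (Dom M f)) (length Fs)) (Dom N ?X)
      = concat (map (\<lambda>A. Dom N (u A)) (Dom M f))" .
  then show ?thesis
    using N.Act_hom[OF N.Comp_Arr[OF c], of "exchange_perm (length (Dom M f)) (length Fs)"] f
    by (simp add: exchanged_def N.Cod_Comp[OF c] length_Dom_u_functors exchange_perm_permutes)
qed

lemma tensor_arr_unique:
  assumes f: "f \<in> Arr M"
  shows "\<exists>!h. h \<in> hom N (map (\<lambda>A. Cod N (u A)) (Dom M f)) (Cod N (u (Cod M f))) \<and>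
    Comp N h (map u (Dom M f)) = exchanged f" (is "\<exists>!h. h \<in> ?H \<and> _")
proof -
  have "Cod N (u (Cod M f)) \<in> Obj N" using f by (simp add: N.Cod_Obj u_Arr M.Cod_Obj)
  from bij_betw_Comp_u[OF M.Dom_Obj[OF f] this]
  have "exchanged f \<in> (\<lambda>h. Comp N h (map u (Dom M f))) ` ?H"
    using exchanged_hom[OF f] by (simp add: bij_betw_def)
  then obtain h where h: "h \<in> ?H" "Comp N h (map u (Dom M f)) = exchanged f"
    by (elim imageE) (use that in simp)
  show ?thesis
  proof (rule ex1I[of _ h])
    fix h' assume h': "h' \<in> ?H \<and> Comp N h' (map u (Dom M f)) = exchanged f"
    then have "Comp N h' (map u (Dom M f)) = Comp N h (map u (Dom M f))" using h(2) by (simp only:)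
    then show "h' = h" by (rule Comp_u_cancel[OF M.Dom_Obj[OF f] conjunct1[OF h'] h(1)])
  qed (simp only: h simp_thms)
qed

lemma tensor_arr_hom:
  "f \<in> Arr M \<Longrightarrow> tensor_arr f \<in> hom N (map (\<lambda>A. Cod N (u A)) (Dom M f)) (Cod N (u (Cod M f)))"
  and Comp_tensor_arr: "f \<in> Arr M \<Longrightarrow> Comp N (tensor_arr f) (map u (Dom M f)) = exchanged f"
  using theI'[OF tensor_arr_unique, of f] by (simp_all add: tensor_arr_def)

lemma composable_tensor_arr_u:
  "f \<in> Arr M \<Longrightarrow> composable N (tensor_arr f) (map u (Dom M f))"
  using tensor_arr_hom[of f] M.Dom_Obj[of f] by (intro composableI) (auto simp: hom_iff u_Arr)

section \<open>Functoriality and symmetry of the tensor product\<close>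

lemma tensor_arr_Idt:
  assumes A: "A \<in> Obj M"
  shows "tensor_arr (Idt M A) = Idt N (Cod N (u A))"
proof (rule Comp_u_cancel[of "[A]"])
  show "tensor_arr (Idt M A) \<in> hom N (map (\<lambda>A. Cod N (u A)) [A]) (Cod N (u A))"
    using tensor_arr_hom[of "Idt M A"] A by (simp add: M.Idt_Arr M.Dom_Idt M.Cod_Idt)
  show "Idt N (Cod N (u A)) \<in> hom N (map (\<lambda>A. Cod N (u A)) [A]) (Cod N (u A))"
    using A by (simp add: N.Idt_hom N.Cod_Obj u_Arr)
  have "map (\<lambda>F. on_arr F (Idt M A)) Fs = map (Idt N) (Dom N (u A))"
    using A Fs by (auto simp: Dom_u functor_Idt)
  then have "exchanged (Idt M A) = u A"
    using A by (simp add: exchanged_def M.Dom_Idt M.Cod_Idt N.Comp_Idt_right u_Arr N.Act_id)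
  then show "Comp N (tensor_arr (Idt M A)) (map u [A]) = Comp N (Idt N (Cod N (u A))) (map u [A])"
    using Comp_tensor_arr[of "Idt M A"] A
    by (simp add: M.Idt_Arr M.Dom_Idt N.Comp_Idt_left u_Arr)
qed (use A in simp)

text \<open>After composition with \<open>u\<close>, the left side is a single exchange of
  \<open>Z\<close>, by functoriality of the given functors. On the right, the defining equation is
  used for every \<open>g\<close> and once more for \<open>f\<close>, which gives juxtaposed
  exchanges of a block permutation of \<open>Z\<close>. The two reorderings agree by
  \<open>exchange_perm_sum_list_left\<close>.\<close>

lemma tensor_arr_Comp:
  assumes c: "composable M f gs"
  shows "tensor_arr (Comp M f gs) = Comp N (tensor_arr f) (map tensor_arr gs)"
proof (rule Comp_u_cancel)
  define m n ks where "m = length gs" and "n = length Fs" and "ks = map (\<lambda>g. length (Dom M g)) gs"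
  define As where "As = concat (map (Dom M) gs)"
  have f: "f \<in> Arr M" and gs: "\<And>g. g \<in> set gs \<Longrightarrow> g \<in> Arr M" and Df: "Dom M f = map (Cod M) gs"
    using c by (auto simp: composable_def)
  have fg: "Comp M f gs \<in> Arr M" "Dom M (Comp M f gs) = As" "Cod M (Comp M f gs) = Cod M f"
    using c by (simp_all add: M.Comp_Arr M.Dom_Comp M.Cod_Comp As_def)
  show "set As \<subseteq> Obj M" using gs M.Dom_Obj by (fastforce simp: As_def)
  show "tensor_arr (Comp M f gs) \<in> hom N (map (\<lambda>A. Cod N (u A)) As) (Cod N (u (Cod M f)))"
    using tensor_arr_hom[OF fg(1)] fg by simp
  have cT: "composable N (tensor_arr f) (map tensor_arr gs)"
    using tensor_arr_hom[OF f] tensor_arr_hom[OF gs]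
    by (intro composableI) (auto simp: hom_iff Df)
  have "map (Dom N) (map tensor_arr gs) = map (\<lambda>g. map (\<lambda>A. Cod N (u A)) (Dom M g)) gs"
    using tensor_arr_hom[OF gs] by (simp add: hom_iff)
  then show "Comp N (tensor_arr f) (map tensor_arr gs)
      \<in> hom N (map (\<lambda>A. Cod N (u A)) As) (Cod N (u (Cod M f)))"
    using N.Comp_hom[OF cT] tensor_arr_hom[OF f] by (simp add: hom_iff As_def map_concat comp_def cong: map_cong)
  define X where "X = Comp N (u (Cod M f)) (map (\<lambda>F. on_arr F f) Fs)"
  define Y where "Y g = Comp N (u (Cod M g)) (map (\<lambda>F. on_arr F g) Fs)" for g
  define hs where "hs = concat (map (\<lambda>F. map (\<lambda>g. on_arr F g) gs) Fs)"
  define Z where "Z = Comp N X hs"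
  have cX: "composable N (u (Cod M f)) (map (\<lambda>F. on_arr F f) Fs)"
    using f by (rule composable_u_functors)
  have cY: "composable N (u (Cod M g)) (map (\<lambda>F. on_arr F g) Fs)" if "g \<in> set gs" for g
    using gs[OF that] by (rule composable_u_functors)
  have cF: "composable N (on_arr F f) (map (\<lambda>g. on_arr F g) gs)" if "F \<in> set Fs" for F
    using Fs[OF that] f gs
    by (intro composableI) (auto simp: functor_Arr Dom_functor Cod_functor Df)
  have Dom_F: "Dom N (on_arr F f) = map (Cod N) (map (\<lambda>g. on_arr F g) gs)" if "F \<in> set Fs" for F
    using cF[OF that] by (simp add: composable_def)
  have cXh: "composable N X hs"
  proof (rule composableI)
    show "X \<in> Arr N" using cX by (simp add: X_def N.Comp_Arr)
    show "h \<in> Arr N" if "h \<in> set hs" for h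
      using that cF by (auto simp: hs_def composable_def)
    show "map (Cod N) hs = Dom N X"
      using Dom_F by (simp add: hs_def X_def N.Dom_Comp[OF cX] map_concat comp_def cong: map_cong)
  qed
  have lh: "length hs = m * n" by (simp add: hs_def m_def n_def length_concat_grid mult.commute)
  have lhs: "map (\<lambda>h. length (Dom N h)) hs = concat (replicate n ks)"
  proof -
    have "map (\<lambda>h. length (Dom N h)) hs = concat (map (\<lambda>F. map (\<lambda>g. length (Dom N (on_arr F g))) gs) Fs)"
      by (simp add: hs_def map_concat comp_def)
    also have "map (\<lambda>F. map (\<lambda>g. length (Dom N (on_arr F g))) gs) Fs = map (\<lambda>F. ks) Fs"
      using Fs gs by (simp add: ks_def Dom_functor cong: map_cong)
    finally show ?thesis by (simp add: map_replicate_const n_def)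
  qed
  let ?b = "block_perm (exchange_perm m n) (concat (replicate n ks))"
  let ?j = "juxtapose_perms (map (\<lambda>k. exchange_perm k n) ks) (map (\<lambda>k. n * k) ks)"
  have ZA: "Z \<in> Arr N" and DZ: "length (Dom N Z) = n * sum_list ks"
  proof -
    show "Z \<in> Arr N" using cXh by (simp add: Z_def N.Comp_Arr)
    have "length (Dom N Z) = sum_list (map (\<lambda>h. length (Dom N h)) hs)"
      using cXh by (simp add: Z_def N.Dom_Comp length_concat comp_def)
    then show "length (Dom N Z) = n * sum_list ks" by (simp add: lhs sum_list_concat_replicate)
  qed
  have "Comp N (tensor_arr (Comp M f gs)) (map u As) = exchanged (Comp M f gs)"
    using Comp_tensor_arr[OF fg(1)] fg by simp
  also have "\<dots> = Act N (exchange_perm (length As) n)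
      (Comp N (u (Cod M f)) (map (\<lambda>F. Comp N (on_arr F f) (map (\<lambda>g. on_arr F g) gs)) Fs))"
    using Fs functor_Comp[OF _ c] by (simp add: exchanged_def fg n_def cong: map_cong)
  also have "Comp N (u (Cod M f)) (map (\<lambda>F. Comp N (on_arr F f) (map (\<lambda>g. on_arr F g) gs)) Fs) = Z"
    unfolding Z_def X_def hs_def by (rule N.Comp_assoc_map[OF cX cF, symmetric])
  also have "length As = sum_list ks" by (simp add: As_def ks_def length_concat comp_def)
  finally have lhs_eq: "Comp N (tensor_arr (Comp M f gs)) (map u As)
      = Act N (exchange_perm (sum_list ks) n) Z" .
  have cTu: "composable N (tensor_arr f) (map (\<lambda>g. u (Cod M g)) gs)"
    using composable_tensor_arr_u[OF f] by (simp add: Df comp_def)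
  have cTY: "composable N (tensor_arr f) (map Y gs)"
    using cTu cY by (auto simp: composable_def Y_def N.Comp_Arr N.Cod_Comp cong: map_cong)
  have DY: "length (Dom N (Y g)) = length (Dom M g) * n" if "g \<in> set gs" for g
    using length_Dom_u_functors[OF gs[OF that]] by (simp add: Y_def n_def)
  have "Comp N (Comp N (tensor_arr f) (map tensor_arr gs)) (map u As)
      = Comp N (Comp N (tensor_arr f) (map tensor_arr gs)) (concat (map (\<lambda>g. map u (Dom M g)) gs))"
    by (simp add: As_def map_concat comp_def)
  also have "\<dots> = Comp N (tensor_arr f) (map (\<lambda>g. Comp N (tensor_arr g) (map u (Dom M g))) gs)"
    by (rule N.Comp_assoc_map[OF cT composable_tensor_arr_u[OF gs]])
  also have "\<dots> = Comp N (tensor_arr f) (map (\<lambda>g. Act N (exchange_perm (length (Dom M g)) n) (Y g)) gs)"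
    using Comp_tensor_arr[OF gs] by (simp add: exchanged_def Y_def n_def cong: map_cong)
  also have "\<dots> = Act N ?j (Comp N (tensor_arr f) (map Y gs))"
    using N.Comp_Act_inner_map[OF cTY, of "\<lambda>g. exchange_perm (length (Dom M g)) n"] DY
    by (simp add: exchange_perm_permutes ks_def comp_def mult.commute[of n] cong: map_cong)
  \<comment> \<open>Regrouping puts the arrows \<open>u\<close> at the codomains of
    \<open>gs\<close>, which are the inputs of \<open>f\<close>, next to
    \<open>tensor_arr f\<close>; its defining equation then applies.\<close>
  also have "Comp N (tensor_arr f) (map Y gs)
      = Comp N (Comp N (tensor_arr f) (map (\<lambda>g. u (Cod M g)) gs))
          (concat (map (\<lambda>g. map (\<lambda>F. on_arr F g) Fs) gs))"
    unfolding Y_def by (rule N.Comp_assoc_map[OF cTu cY, symmetric])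
  also have "Comp N (tensor_arr f) (map (\<lambda>g. u (Cod M g)) gs) = Act N (exchange_perm m n) X"
    using Comp_tensor_arr[OF f] by (simp add: Df comp_def exchanged_def m_def n_def X_def)
  \<comment> \<open>Grouped by \<open>g\<close>, these arrows are \<open>hs\<close>, grouped by
    functor, reordered by the same exchange that stands on \<open>X\<close>; equivariance in the
    outer arrow turns it into a block permutation.\<close>
  also have "concat (map (\<lambda>g. map (\<lambda>F. on_arr F g) Fs) gs) = permute_list (exchange_perm m n) hs"
    unfolding m_def n_def hs_def by (rule permute_list_exchange_perm[symmetric])
  also have "Comp N (Act N (exchange_perm m n) X) (permute_list (exchange_perm m n) hs) = Act N ?b Z"
    using N.Comp_Act_outer[OF cXh] by (simp add: lh exchange_perm_permutes lhs Z_def)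
  also have "Act N ?j (Act N ?b Z) = Act N (?b \<circ> ?j) Z"
  proof (rule N.Act_comp[symmetric, OF ZA])
    show "?j permutes {..<length (Dom N Z)}"
      using juxtapose_perms_permutes[of "map (\<lambda>k. exchange_perm k n) ks" "map (\<lambda>k. n * k) ks"]
      by (simp add: DZ list_all2_conv_all_nth exchange_perm_permutes'
          sum_list_const_mult[of n id, simplified])
    have "length (concat (replicate n ks)) = m * n"
      by (simp add: length_concat sum_list_replicate ks_def m_def)
    then show "?b permutes {..<length (Dom N Z)}"
      using block_perm_permutes[of "exchange_perm m n" "concat (replicate n ks)"]
      by (simp add: DZ sum_list_concat_replicate exchange_perm_permutes)
  qed
  also have "?b \<circ> ?j = exchange_perm (sum_list ks) n"
    using exchange_perm_sum_list_left[of ks n] by (simp add: ks_def m_def)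
  finally show "Comp N (tensor_arr (Comp M f gs)) (map u As)
      = Comp N (Comp N (tensor_arr f) (map tensor_arr gs)) (map u As)"
    using lhs_eq by simp
qed

text \<open>The given functors respect the action, so \<sigma> acts on \<open>X\<close> through one
  copy per functor, juxtaposed. On the tensor side it permutes the domains of the \<open>u A\<close>
  as blocks. By \<open>exchange_perm_equivariant\<close> the exchange carries one action to the
  other.\<close>

lemma tensor_arr_Act:
  assumes f: "f \<in> Arr M" and \<sigma>: "\<sigma> permutes {..<length (Dom M f)}"
  shows "tensor_arr (Act M \<sigma> f) = Act N \<sigma> (tensor_arr f)"
proof (rule Comp_u_cancel)
  define m n where "m = length (Dom M f)" and "n = length Fs"
  define As where "As = permute_list \<sigma> (Dom M f)"
  have \<sigma>m: "\<sigma> permutes {..<m}" using \<sigma> by (simp add: m_def)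
  have sf: "Act M \<sigma> f \<in> Arr M" "Dom M (Act M \<sigma> f) = As" "Cod M (Act M \<sigma> f) = Cod M f"
    using f \<sigma> by (simp_all add: M.Act_Arr M.Dom_Act M.Cod_Act As_def)
  show "set As \<subseteq> Obj M" using M.Dom_Obj[OF sf(1)] sf by simp
  show "tensor_arr (Act M \<sigma> f) \<in> hom N (map (\<lambda>A. Cod N (u A)) As) (Cod N (u (Cod M f)))"
    using tensor_arr_hom[OF sf(1)] sf by simp
  have T: "tensor_arr f \<in> Arr N" "length (Dom N (tensor_arr f)) = m"
    using tensor_arr_hom[OF f] by (simp_all add: hom_iff m_def)
  show "Act N \<sigma> (tensor_arr f) \<in> hom N (map (\<lambda>A. Cod N (u A)) As) (Cod N (u (Cod M f)))"
    using N.Act_hom[OF T(1), of \<sigma>] T(2) \<sigma> tensor_arr_hom[OF f]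
    by (simp add: m_def hom_iff As_def permute_list_map)
  define X where "X = Comp N (u (Cod M f)) (map (\<lambda>F. on_arr F f) Fs)"
  have cX: "composable N (u (Cod M f)) (map (\<lambda>F. on_arr F f) Fs)"
    using f by (rule composable_u_functors)
  have XA: "X \<in> Arr N" and DX: "length (Dom N X) = m * n"
    using cX length_Dom_u_functors[OF f] by (simp_all add: X_def N.Comp_Arr m_def n_def)
  let ?b = "block_perm \<sigma> (replicate m n)"
  let ?j = "juxtapose_perms (replicate n \<sigma>) (replicate n m)"
  let ?e = "exchange_perm m n"
  have b: "?b permutes {..<length (Dom N X)}"
    using block_perm_permutes[of \<sigma> "replicate m n"] \<sigma>m by (simp add: DX sum_list_replicate)
  have j: "?j permutes {..<length (Dom N X)}"
    using juxtapose_perms_permutes[of "replicate n \<sigma>" "replicate n m"] \<sigma>m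
    by (simp add: DX sum_list_replicate list_all2_conv_all_nth mult.commute)
  have e: "?e permutes {..<length (Dom N X)}" by (simp add: DX exchange_perm_permutes)
  have "Comp N (u (Cod M f)) (map (\<lambda>F. on_arr F (Act M \<sigma> f)) Fs)
      = Comp N (u (Cod M f)) (map (\<lambda>F. Act N \<sigma> (on_arr F f)) Fs)"
    using Fs by (simp add: functor_Act f \<sigma> cong: map_cong)
  also have "\<dots> = Act N (juxtapose_perms (map (\<lambda>F. \<sigma>) Fs) (map (\<lambda>F. length (Dom N (on_arr F f))) Fs)) X"
    unfolding X_def using Fs f \<sigma> by (intro N.Comp_Act_inner_map[OF cX]) (simp add: Dom_functor)
  also have "map (\<lambda>F. length (Dom N (on_arr F f))) Fs = map (\<lambda>F. m) Fs"
    using Fs f by (simp add: Dom_functor m_def)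
  finally have "exchanged (Act M \<sigma> f) = Act N ?e (Act N ?j X)"
    using sf \<sigma> by (simp add: exchanged_def As_def m_def n_def map_replicate_const)
  also have "\<dots> = Act N (?e \<circ> ?b) X"
    unfolding exchange_perm_equivariant[OF \<sigma>m] by (rule N.Act_comp[symmetric, OF XA j e])
  also have "\<dots> = Act N ?b (Comp N (tensor_arr f) (map u (Dom M f)))"
    unfolding Comp_tensor_arr[OF f] N.Act_comp[OF XA e b] by (simp add: exchanged_def X_def m_def n_def)
  \<comment> \<open>Every \<open>u A\<close> has one input per functor, so all blocks have the same
    length \<open>n\<close>.\<close>
  also have "replicate m n = map (\<lambda>g. length (Dom N g)) (map u (Dom M f))"
    using M.Dom_Obj[OF f] by (intro nth_equalityI) (simp_all add: m_def n_def Dom_u subset_iff)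
  also have "Act N (block_perm \<sigma> \<dots>) (Comp N (tensor_arr f) (map u (Dom M f)))
      = Comp N (Act N \<sigma> (tensor_arr f)) (permute_list \<sigma> (map u (Dom M f)))"
    using \<sigma> by (intro N.Comp_Act_outer[symmetric] composable_tensor_arr_u f) simp
  also have "permute_list \<sigma> (map u (Dom M f)) = map u As"
    using \<sigma> by (simp add: As_def permute_list_map)
  finally show "Comp N (tensor_arr (Act M \<sigma> f)) (map u As) = Comp N (Act N \<sigma> (tensor_arr f)) (map u As)"
    using Comp_tensor_arr[OF sf(1)] sf by simp
qed

lemma on_tensor_functor [simp]:
  "A \<in> Obj M \<Longrightarrow> on_obj tensor_functor A = Cod N (u A)"
  "f \<in> Arr M \<Longrightarrow> on_arr tensor_functor f = tensor_arr f"
  by (simp_all add: tensor_functor_def)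

lemma symmetric_functor_tensor: "symmetric_functor M N tensor_functor"
  unfolding symmetric_functor_def
proof (intro conjI ballI allI impI)
  show "on_obj tensor_functor \<in> Obj M \<rightarrow>\<^sub>E Obj N"
    by (simp add: tensor_functor_def N.Cod_Obj u_Arr)
  show "on_arr tensor_functor \<in> extensional (Arr M)" by (simp add: tensor_functor_def)
  show "on_arr tensor_functor f \<in> hom N (map (on_obj tensor_functor) (Dom M f)) (on_obj tensor_functor (Cod M f))"
    if f: "f \<in> Arr M" for f
  proof -
    have "map (on_obj tensor_functor) (Dom M f) = map (\<lambda>A. Cod N (u A)) (Dom M f)"
      using M.Dom_Obj[OF f] by auto
    then show ?thesis using tensor_arr_hom[OF f] f by (simp add: M.Cod_Obj cong: map_cong)
  qed
  show "on_arr tensor_functor (Idt M A) = Idt N (on_obj tensor_functor A)" if "A \<in> Obj M" for A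
    using that by (simp add: M.Idt_Arr tensor_arr_Idt)
  show "on_arr tensor_functor (Comp M f gs) = Comp N (on_arr tensor_functor f) (map (on_arr tensor_functor) gs)"
    if c: "composable M f gs" for f gs
  proof -
    have "map (on_arr tensor_functor) gs = map tensor_arr gs" "f \<in> Arr M"
      using c by (auto simp: composable_def)
    then show ?thesis by (simp add: M.Comp_Arr[OF c] tensor_arr_Comp[OF c] cong: map_cong)
  qed
  show "on_arr tensor_functor (Act M \<sigma> f) = Act N \<sigma> (on_arr tensor_functor f)"
    if "f \<in> Arr M" "\<sigma> permutes {..<length (Dom M f)}" for f \<sigma>
    using that by (simp add: M.Act_Arr tensor_arr_Act)
qed

definition tensor_universal :: "('o, 'a, 'p, 'b) mtrans" where
  "tensor_universal = MTrans Fs tensor_functor (\<lambda>A \<in> Obj M. u A)"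

text \<open>Naturality holds by construction: it is the equation that defines
  \<open>tensor_arr\<close>.\<close>

lemma tensor_universal_trans: "tensor_universal \<in> Arr (functor_multicat M N)"
proof -
  have "natural M N tensor_universal"
    unfolding natural_def
  proof
    fix f assume f: "f \<in> Arr M"
    then have "map (component tensor_universal) (Dom M f) = map u (Dom M f)"
      using M.Dom_Obj[OF f] by (auto simp: tensor_universal_def)
    then show "Comp N (on_arr (tgt tensor_universal) f) (map (component tensor_universal) (Dom M f))
      = Act N (exchange_perm (length (Dom M f)) (length (src tensor_universal)))
        (Comp N (component tensor_universal (Cod M f)) (map (\<lambda>F. on_arr F f) (src tensor_universal)))"
      using f Comp_tensor_arr[OF f] 
      by (simp add: tensor_universal_def exchanged_def M.Cod_Obj cong: map_cong)
  qed
  then show ?thesis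
    unfolding trans_iff
    by (auto simp: tensor_universal_def Fs symmetric_functor_tensor hom_iff u_Arr Dom_u)
qed

end

section \<open>Preuniversal transformations\<close>

context functors
begin

text \<open>Factorizations exist and are unique at each object, so only the naturality of the
  resulting family \<open>b\<close> is at issue. The two sides of its naturality equation at
  \<open>f\<close> agree after composition with the components of \<open>\<alpha>\<close> at the
  inputs of \<open>f\<close>, by naturality of \<open>\<gamma>\<close> and of
  \<open>\<alpha>\<close>.\<close>

lemma preuniversal_pointwise:
  assumes rep: "representable N" and \<alpha>: "\<alpha> \<in> Arr (functor_multicat M N)"
    and pre: "\<And>A. A \<in> Obj M \<Longrightarrow> preuniversal N (component \<alpha> A)"
  shows "preuniversal (functor_multicat M N) \<alpha>"
proof (rule FM.preuniversalI[OF \<alpha>])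
  fix \<gamma> assume \<gamma>: "\<gamma> \<in> Arr (functor_multicat M N)"
    and "Dom (functor_multicat M N) \<gamma> = Dom (functor_multicat M N) \<alpha>"
  then have src: "src \<gamma> = src \<alpha>" by simp
  define F G where "F = tgt \<alpha>" and "G = tgt \<gamma>"
  have F: "symmetric_functor M N F" and G: "symmetric_functor M N G"
    using \<alpha> \<gamma> by (simp_all add: F_def G_def functor_tgt)
  have "\<exists>b. b \<in> hom N [on_obj F A] (on_obj G A) \<and> Comp N b [component \<alpha> A] = component \<gamma> A"
    if A: "A \<in> Obj M" for A
    using N.preuniversal_factor[OF pre[OF A], of "component \<gamma> A" "on_obj G A"] A \<alpha> \<gamma>
    by (auto simp: hom_iff component_Arr Dom_component Cod_component src F_def G_def)
  then obtain b where b: "\<And>A. A \<in> Obj M \<Longrightarrow> b A \<in> hom N [on_obj F A] (on_obj G A)"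
    and b\<alpha>: "\<And>A. A \<in> Obj M \<Longrightarrow> Comp N (b A) [component \<alpha> A] = component \<gamma> A"
    by metis
  define \<beta> where "\<beta> = MTrans [F] G (\<lambda>A \<in> Obj M. b A)"
  have "natural M N \<beta>"
    unfolding natural_def
  proof
    fix f assume f: "f \<in> Arr M"
    define As A where "As = Dom M f" and "A = Cod M f"
    have As: "set As \<subseteq> Obj M" and A: "A \<in> Obj M"
      using f by (simp_all add: As_def A_def M.Dom_Obj M.Cod_Obj)
    have c\<alpha>: "composable N (b B) [component \<alpha> B]" if "B \<in> Obj M" for B
      using that b[OF that] \<alpha>
      by (simp add: composable_def hom_iff component_Arr Cod_component F_def)
    have cGb: "composable N (on_arr G f) (map b As)"
      unfolding As_def using b G f by (intro composable_functor_components) (auto simp: hom_iff)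
    have cbF: "composable N (b A) [on_arr F f]"
      using b[OF A] F f by (simp add: composable_def hom_iff functor_Arr Cod_functor A_def)
    have cF\<alpha>: "composable N (on_arr F f) (map (component \<alpha>) As)"
      unfolding As_def using F f \<alpha>
      by (intro composable_functor_components) (auto simp: component_Arr Cod_component F_def)
    have c\<alpha>F: "composable N (component \<alpha> A) (map (\<lambda>F. on_arr F f) (src \<alpha>))"
      unfolding A_def using \<alpha> f
      by (intro composable_functors functor_src) (auto simp: component_Arr Dom_component M.Cod_Obj)
    let ?e = "exchange_perm (length As) (length (src \<alpha>))"
    have e: "?e permutes {..<length (Dom N (Comp N (component \<alpha> A) (map (\<lambda>F. on_arr F f) (src \<alpha>))))}"
      using functor_src[OF \<alpha>] f
      by (simp add: N.Dom_Comp[OF c\<alpha>F] length_concat comp_def Dom_functor As_def sum_list_triv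
          exchange_perm_permutes' cong: map_cong)
    have "Comp N (Comp N (on_arr G f) (map b As)) (map (component \<alpha>) As)
        = Comp N (Comp N (on_arr G f) (map b As)) (concat (map (\<lambda>B. [component \<alpha> B]) As))"
      by simp
    also have "\<dots> = Comp N (on_arr G f) (map (\<lambda>B. Comp N (b B) [component \<alpha> B]) As)"
      using As c\<alpha> by (intro N.Comp_assoc_map[OF cGb]) auto
    also have "map (\<lambda>B. Comp N (b B) [component \<alpha> B]) As = map (component \<gamma>) As"
      using As b\<alpha> by auto
    also have "Comp N (on_arr G f) \<dots> = Act N ?e (Comp N (component \<gamma> A) (map (\<lambda>F. on_arr F f) (src \<alpha>)))"
      using naturality[OF \<gamma> f] by (simp add: src G_def As_def A_def)
    also have "component \<gamma> A = Comp N (b A) [component \<alpha> A]" using b\<alpha>[OF A] by simp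
    also have "Comp N \<dots> (map (\<lambda>F. on_arr F f) (src \<alpha>))
        = Comp N (b A) [Comp N (component \<alpha> A) (map (\<lambda>F. on_arr F f) (src \<alpha>))]"
      by (rule N.Comp_assoc_single[OF c\<alpha>[OF A] c\<alpha>F])
    \<comment> \<open>The permutation introduced by naturality of \<open>\<gamma>\<close> passes
      inside the unary arrow \<open>b A\<close>, where naturality of \<open>\<alpha>\<close> absorbs
      it.\<close>
    also have "Act N ?e \<dots> = Comp N (b A) [Act N ?e (Comp N (component \<alpha> A) (map (\<lambda>F. on_arr F f) (src \<alpha>)))]"
      using c\<alpha>[OF A] e
      by (intro N.Comp_Act_inner_single[symmetric])
        (simp_all add: composable_def N.Comp_Arr[OF c\<alpha>F] N.Cod_Comp[OF c\<alpha>F])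
    also have "Act N ?e (Comp N (component \<alpha> A) (map (\<lambda>F. on_arr F f) (src \<alpha>)))
        = Comp N (on_arr F f) (map (component \<alpha>) As)"
      using naturality[OF \<alpha> f] by (simp add: F_def As_def A_def)
    also have "Comp N (b A) [\<dots>] = Comp N (Comp N (b A) [on_arr F f]) (map (component \<alpha>) As)"
      by (rule N.Comp_assoc_single[OF cbF cF\<alpha>, symmetric])
    finally have eq: "Comp N (Comp N (on_arr G f) (map b As)) (map (component \<alpha>) As)
      = Comp N (Comp N (b A) [on_arr F f]) (map (component \<alpha>) As)" .
    have CF: "map (Cod N) (map (component \<alpha>) As) = map (on_obj F) As"
      using As \<alpha> by (auto simp: Cod_component F_def)
    \<comment> \<open>Since \<open>f\<close> may have several inputs or none, a whole list of
      components has to be cancelled at once.\<close>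
    have "inj_on (\<lambda>g. Comp N g (map (component \<alpha>) As)) (hom N (map (Cod N) (map (component \<alpha>) As)) (on_obj G A))"
      using As pre functor_Obj[OF G A]
      by (intro bij_betw_imp_inj_on[OF N.bij_betw_Comp_preuniversals[OF rep]]) auto
    then have inj: "inj_on (\<lambda>g. Comp N g (map (component \<alpha>) As)) (hom N (map (on_obj F) As) (on_obj G A))"
      unfolding CF .
    have "map (Dom N) (map b As) = map (\<lambda>B. [on_obj F B]) As"
      using As b by (auto simp: hom_iff)
    then have "Comp N (on_arr G f) (map b As) \<in> hom N (map (on_obj F) As) (on_obj G A)"
      using N.Comp_hom[OF cGb] G f by (simp add: Cod_functor A_def comp_def cong: map_cong)
    moreover have "Comp N (b A) [on_arr F f] \<in> hom N (map (on_obj F) As) (on_obj G A)"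
      using N.Comp_hom[OF cbF] F f b[OF A] by (simp add: Dom_functor As_def hom_iff)
    ultimately have "Comp N (on_arr G f) (map b As) = Comp N (b A) [on_arr F f]"
      by (rule inj_onD[OF inj eq])
    moreover have "map (component \<beta>) As = map b As" using As by (auto simp: \<beta>_def)
    \<comment> \<open>As \<open>\<beta>\<close> is unary, the exchange in its naturality condition
      is the identity.\<close>
    ultimately show "Comp N (on_arr (tgt \<beta>) f) (map (component \<beta>) (Dom M f))
      = Act N (exchange_perm (length (Dom M f)) (length (src \<beta>)))
        (Comp N (component \<beta> (Cod M f)) (map (\<lambda>F. on_arr F f) (src \<beta>)))"
      using A by (simp add: \<beta>_def As_def A_def N.Act_id N.Comp_Arr[OF cbF, unfolded A_def]
          cong: map_cong)
  qed
  then have \<beta>: "\<beta> \<in> Arr (functor_multicat M N)"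
    unfolding trans_iff using F G b by (simp add: \<beta>_def)
  have c: "composable (functor_multicat M N) \<beta> [\<alpha>]"
    using \<alpha> \<beta> by (simp add: composable_def) (simp add: \<beta>_def F_def)
  have "Comp (functor_multicat M N) \<beta> [\<alpha>] = \<gamma>"
    using b\<alpha> by (intro trans_eqI Comp_trans c \<gamma>) (simp_all add: src \<beta>_def G_def)
  then show "\<exists>\<beta> \<in> hom (functor_multicat M N) [Cod (functor_multicat M N) \<alpha>] (Cod (functor_multicat M N) \<gamma>).
      Comp (functor_multicat M N) \<beta> [\<alpha>] = \<gamma>"
    using \<beta> by (intro bexI[of _ \<beta>]) (simp_all add: hom_iff, simp_all add: \<beta>_def F_def G_def)
next
  fix \<beta> \<beta>' assume \<beta>: "\<beta> \<in> Arr (functor_multicat M N)" "\<beta>' \<in> Arr (functor_multicat M N)"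
    and "Dom (functor_multicat M N) \<beta> = [Cod (functor_multicat M N) \<alpha>]"
      "Dom (functor_multicat M N) \<beta>' = [Cod (functor_multicat M N) \<alpha>]"
      "Cod (functor_multicat M N) \<beta> = Cod (functor_multicat M N) \<beta>'"
    and eq: "Comp (functor_multicat M N) \<beta> [\<alpha>] = Comp (functor_multicat M N) \<beta>' [\<alpha>]"
  then have st: "src \<beta> = [tgt \<alpha>]" "src \<beta>' = [tgt \<alpha>]" "tgt \<beta> = tgt \<beta>'" by simp_all
  show "\<beta> = \<beta>'"
  proof (rule trans_eqI[OF \<beta>])
    fix A assume A: "A \<in> Obj M"
    show "component \<beta> A = component \<beta>' A"
    proof (rule N.preuniversal_cancel[OF pre[OF A]])
      show "Comp N (component \<beta> A) [component \<alpha> A] = Comp N (component \<beta>' A) [component \<alpha> A]"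
        using arg_cong[OF eq, of "\<lambda>\<delta>. component \<delta> A"] A by simp
    qed (use \<alpha> \<beta> st A in \<open>auto simp: hom_iff component_Arr Dom_component Cod_component\<close>)
  qed (simp_all add: st)
qed

text \<open>The arrows at the individual objects are chosen independently and assembled by the
  tensor construction. The conclusion is kept pointwise, since the comparison with an arbitrary
  preuniversal transformation needs the components.\<close>

lemma preuniversal_exists:
  assumes rep: "representable N" and Fs: "\<And>F. F \<in> set Fs \<Longrightarrow> symmetric_functor M N F"
  obtains \<eta> where "\<eta> \<in> Arr (functor_multicat M N)" "src \<eta> = Fs"
    "\<And>A. A \<in> Obj M \<Longrightarrow> preuniversal N (component \<eta> A)"
proof -
  have "\<exists>v. preuniversal N v \<and> Dom N v = map (\<lambda>F. on_obj F A) Fs" if "A \<in> Obj M" for A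
    using rep Fs that functor_Obj unfolding representable_def by (auto simp: image_subset_iff)
  then obtain u where "\<And>A. A \<in> Obj M \<Longrightarrow> preuniversal N (u A) \<and> Dom N (u A) = map (\<lambda>F. on_obj F A) Fs"
    by metis
  then interpret tensor_product M N Fs u
    using rep Fs by unfold_locales auto
  show ?thesis
    using that[OF tensor_universal_trans] u by (simp add: tensor_universal_def)
qed

lemma preuniversal_component:
  assumes rep: "representable N" and \<alpha>: "preuniversal (functor_multicat M N) \<alpha>" and A: "A \<in> Obj M"
  shows "preuniversal N (component \<alpha> A)"
proof -
  have \<alpha>A: "\<alpha> \<in> Arr (functor_multicat M N)" using \<alpha> by (simp add: preuniversal_def)
  obtain \<eta> where \<eta>: "\<eta> \<in> Arr (functor_multicat M N)" "src \<eta> = src \<alpha>"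
    and pre: "\<And>A. A \<in> Obj M \<Longrightarrow> preuniversal N (component \<eta> A)"
    using preuniversal_exists[OF rep functor_src[OF \<alpha>A]] by metis
  obtain \<beta> \<gamma> where \<beta>: "\<beta> \<in> hom (functor_multicat M N) [tgt \<eta>] (tgt \<alpha>)"
    and \<gamma>: "\<gamma> \<in> hom (functor_multicat M N) [tgt \<alpha>] (tgt \<eta>)"
    and eqs: "Comp (functor_multicat M N) \<beta> [\<eta>] = \<alpha>"
      "Comp (functor_multicat M N) \<gamma> [\<beta>] = Idt (functor_multicat M N) (tgt \<eta>)"
      "Comp (functor_multicat M N) \<beta> [\<gamma>] = Idt (functor_multicat M N) (tgt \<alpha>)"
    using FM.preuniversal_iso[OF preuniversal_pointwise[OF rep \<eta>(1) pre] \<alpha>] \<eta>(2) by auto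
  \<comment> \<open>Evaluation at \<open>A\<close> respects composition and identities, so the
    components of \<open>\<beta>\<close> and \<open>\<gamma>\<close> are mutually inverse in
    \<open>N\<close>.\<close>
  have "preuniversal N (Comp N (component \<beta> A) [component \<eta> A])"
  proof (rule N.preuniversal_Comp_iso[OF pre[OF A]])
    show "component \<beta> A \<in> hom N [Cod N (component \<eta> A)] (on_obj (tgt \<alpha>) A)"
      "component \<gamma> A \<in> hom N [on_obj (tgt \<alpha>) A] (Cod N (component \<eta> A))"
      using \<beta> \<gamma> \<eta> A by (simp_all add: hom_iff component_Arr Dom_component Cod_component)
    show "Comp N (component \<gamma> A) [component \<beta> A] = Idt N (Cod N (component \<eta> A))"
      using arg_cong[OF eqs(2), of "\<lambda>\<delta>. component \<delta> A"] \<eta> A by (simp add: Cod_component)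
    show "Comp N (component \<beta> A) [component \<gamma> A] = Idt N (on_obj (tgt \<alpha>) A)"
      using arg_cong[OF eqs(3), of "\<lambda>\<delta>. component \<delta> A"] A by simp
  qed
  then show ?thesis using arg_cong[OF eqs(1), of "\<lambda>\<delta>. component \<delta> A"] A by simp
qed

end

theorem proposition3p18:
  fixes M :: "('o, 'a) multicat" and N :: "('p, 'b) multicat"
  assumes "symmetric_multicategory M" and "symmetric_multicategory N"
    and "representable N"
  shows "representable (functor_multicat M N)"
proof -
  interpret functors M N using assms(1,2) by (rule functors.intro)
  note rep = assms(3)
  show ?thesis
    unfolding representable_def
  proof (intro conjI allI impI)
    fix Fs assume "set Fs \<subseteq> Obj (functor_multicat M N)"
    then obtain \<eta> where "\<eta> \<in> Arr (functor_multicat M N)" "src \<eta> = Fs"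
      "\<And>A. A \<in> Obj M \<Longrightarrow> preuniversal N (component \<eta> A)"
      using preuniversal_exists[OF rep, of Fs] by (auto simp: subset_iff)
    then show "\<exists>\<eta>. preuniversal (functor_multicat M N) \<eta> \<and> Dom (functor_multicat M N) \<eta> = Fs"
      using preuniversal_pointwise[OF rep] by auto
  next
    fix \<alpha> \<beta>s
    assume \<alpha>: "preuniversal (functor_multicat M N) \<alpha>"
      and \<beta>s: "\<forall>\<beta> \<in> set \<beta>s. preuniversal (functor_multicat M N) \<beta>"
      and c: "composable (functor_multicat M N) \<alpha> \<beta>s"
    show "preuniversal (functor_multicat M N) (Comp (functor_multicat M N) \<alpha> \<beta>s)"
    proof (rule preuniversal_pointwise[OF rep Comp_trans[OF c]])
      fix A assume A: "A \<in> Obj M"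
      have "\<forall>v \<in> set (map (\<lambda>\<beta>. component \<beta> A) \<beta>s). preuniversal N v"
        using \<beta>s preuniversal_component[OF rep _ A] by auto
      then have "preuniversal N (Comp N (component \<alpha> A) (map (\<lambda>\<beta>. component \<beta> A) \<beta>s))"
        using rep preuniversal_component[OF rep \<alpha> A] composable_component[OF c A]
        unfolding representable_def by blast
      then show "preuniversal N (component (Comp (functor_multicat M N) \<alpha> \<beta>s) A)" using A by simp
    qed
  qed
qed

end
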